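(* Let $\alpha\in(0,2)$ and let $(E,d,\mu)$ be a metric measure space with heat kernel $p_t(x,y)$, associated Markov process $(X_t,P_x)$ and volume growth $V$, satisfying the volume condition (V) and the kernel estimate (K) described in the context. Then there is a constant $c>0$ such that for all $r>1$, $x\in E$, $$E_y\tau_{B(x,r)}\le c\,r^{\alpha/2},\qquad y\in B(x,r),$$ and $$E_x\tau_{B(x,r)}\asymp r^{\alpha/2},$$ where the comparison constants do not depend on $x$ and $r$.
   Context: $(E,d)$ is a metric space with a measure $\mu$ that supports a heat kernel $p_t(x,y)$: $p_t(\cdot,\cdot)$, $t>0$, is a nonnegative $\mu\times\mu$-measurable function such that for $\mu$-almost all $x,y\in E$ and all $s,t>0$: $p_t(x,y)=p_t(y,x)$, $\int_E p_t(x,y)\,d\mu(y)=1$, $p_{t+s}(x,y)=\int_E p_t(x,z)p_s(z,y)\,d\mu(z)$; and for each $u\in L^2(E,\mu)$, $\int_E p_t(x,y)u(y)\,d\mu(y)\to u(x)$ in $L^2$ as $t\to0^+$. It is assumed that this kernel gives rise to an associated (right-continuous, strong) Markov process $(X_t,P_x)$ with $P_x[X_t\in B]=\int_B p_t(x,y)\,d\mu(y)$; $E_x$ denotes expectation with respect to $P_x$. $B(x,r)$ is the open ball with centre $x$ and radius $r$. The space is homogeneous: there is a function $V(r)\in(0,\infty)$ with $V(r)=\mu(B(x,r))$ for all $x\in E$, called the volume growth. (V): there exist $A\ge1$ and $c_1<1$ such that $V(r)\le c_1V(r+A)$ and $V(r+1)\asymp V(r)$ for $r\ge1$. (K): for any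 $M>0$, $p_t(x,y)\asymp t\,d(x,y)^{-1-\alpha/2}V(d(x,y))^{-1}$ whenever $d(x,y)>Mt^{2/\alpha}$ and $d(x,y)>1$ (comparison constants may depend on $M$). For a measurable set $D$, the exit time is $\tau_D=\inf\{t\ge0: X_t\notin D\}$. $f\asymp g$ means that there is $c>0$ with $c^{-1}<f/g<c$ on the indicated range. *)

theory Defs
  imports "HOL-Probability.Probability"
begin

definition comparable_on :: "'i set \<Rightarrow> ('i \<Rightarrow> real) \<Rightarrow> ('i \<Rightarrow> real) \<Rightarrow> bool" where
  "comparable_on S f g \<longleftrightarrow> (\<exists>c>0. \<forall>i\<in>S. 1 / c < f i / g i \<and> f i / g i < c)"

definition square_integrable :: "'e measure \<Rightarrow> ('e \<Rightarrow> real) \<Rightarrow> bool" where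
  "square_integrable \<mu> u \<longleftrightarrow> u \<in> borel_measurable \<mu> \<and> integrable \<mu> (\<lambda>x. (u x)\<^sup>2)"

text \<open>The metric space is the whole carrier type, with a Borel measure. The identities hold only
  almost everywhere, with an exceptional set that may depend on the times. They are stated with
  the nonnegative integral, so that no integrability has to be presupposed.\<close>

locale heat_kernel =
  fixes \<mu> :: "'e::metric_space measure" and p :: "real \<Rightarrow> 'e \<Rightarrow> 'e \<Rightarrow> real"
  assumes sets_mu: "sets \<mu> = sets borel"
    and measurable: "\<And>t. 0 < t \<Longrightarrow> (\<lambda>(x, y). p t x y) \<in> borel_measurable (\<mu> \<Otimes>\<^sub>M \<mu>)"
    and nonneg: "\<And>t x y. 0 < t \<Longrightarrow> 0 \<le> p t x y"
    and symmetric: "\<And>t. 0 < t \<Longrightarrow> AE (x, y) in \<mu> \<Otimes>\<^sub>M \<mu>. p t x y = p t y x"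
    and conservative: "\<And>t. 0 < t \<Longrightarrow> AE x in \<mu>. (\<integral>\<^sup>+y. ennreal (p t x y) \<partial>\<mu>) = 1"
    and semigroup: "\<And>s t. 0 < s \<Longrightarrow> 0 < t \<Longrightarrow> AE (x, y) in \<mu> \<Otimes>\<^sub>M \<mu>.
      ennreal (p (t + s) x y) = (\<integral>\<^sup>+z. ennreal (p t x z * p s z y) \<partial>\<mu>)"
    and L2_continuous: "\<And>u. square_integrable \<mu> u \<Longrightarrow>
      ((\<lambda>t. \<integral>\<^sup>+x. ennreal (((\<integral>y. p t x y * u y \<partial>\<mu>) - u x)\<^sup>2) \<partial>\<mu>) \<longlongrightarrow> 0) (at_right 0)"

text \<open>A normal, conservative Markov process with right-continuous paths that is strong Markov with
  respect to a filtration to which it is adapted. The filtration is indexed by the extended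
  half-line so that stopping times may take the value infinity; the values of
  \<^term>\<open>X t\<close> for \<^term>\<open>t < (0::real)\<close> are irrelevant. Constant times \<^term>\<open>T\<close> yield the simple
  Markov property.\<close>

locale strong_markov_process =
  filtration "space M" F
  for M :: "'w measure" and F :: "ennreal \<Rightarrow> 'w measure" +
  fixes X :: "real \<Rightarrow> 'w \<Rightarrow> 'e::metric_space" and P :: "'e \<Rightarrow> 'w measure"
  assumes subalgebra_F: "\<And>s. subalgebra M (F s)"
    and prob_space_P: "\<And>x. prob_space (P x)"
    and sets_P: "\<And>x. sets (P x) = sets M"
    and adapted: "\<And>t. 0 \<le> t \<Longrightarrow> X t \<in> F (ennreal t) \<rightarrow>\<^sub>M borel"
    and right_continuous: "\<And>\<omega> t. \<omega> \<in> space M \<Longrightarrow> 0 \<le> t \<Longrightarrow> continuous (at_right t) (\<lambda>s. X s \<omega>)"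
    and normal: "\<And>x. AE \<omega> in P x. X 0 \<omega> = x"
    and measurable_start: "\<And>t B. 0 \<le> t \<Longrightarrow> B \<in> sets borel \<Longrightarrow>
      (\<lambda>x. measure (P x) {\<omega> \<in> space M. X t \<omega> \<in> B}) \<in> borel_measurable borel"
    and strong_markov: "\<And>T x t B. stopping_time F T \<Longrightarrow> 0 \<le> t \<Longrightarrow> B \<in> sets borel \<Longrightarrow>
      AE \<omega> in P x. T \<omega> < \<infinity> \<longrightarrow>
        real_cond_exp (P x) (pre_sigma T)
          (indicator {\<omega> \<in> space M. T \<omega> < \<infinity> \<and> X (enn2real (T \<omega>) + t) \<omega> \<in> B}) \<omega>
        = measure (P (X (enn2real (T \<omega>)) \<omega>)) {\<omega>' \<in> space M. X t \<omega>' \<in> B}"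

definition has_transition_density ::
    "'w measure \<Rightarrow> (real \<Rightarrow> 'w \<Rightarrow> 'e) \<Rightarrow> ('e \<Rightarrow> 'w measure) \<Rightarrow> 'e::metric_space measure
      \<Rightarrow> (real \<Rightarrow> 'e \<Rightarrow> 'e \<Rightarrow> real) \<Rightarrow> bool" where
  "has_transition_density M X P \<mu> p \<longleftrightarrow>
    (\<forall>t>0. \<forall>x. \<forall>B\<in>sets borel.
      emeasure (P x) {\<omega> \<in> space M. X t \<omega> \<in> B} = (\<integral>\<^sup>+y\<in>B. ennreal (p t x y) \<partial>\<mu>))"

definition volume_growth :: "'e::metric_space measure \<Rightarrow> (real \<Rightarrow> real) \<Rightarrow> bool" where
  "volume_growth \<mu> V \<longleftrightarrow> (\<forall>r>0. 0 < V r \<and> (\<forall>x. emeasure \<mu> (ball x r) = ennreal (V r)))"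

definition volume_condition :: "(real \<Rightarrow> real) \<Rightarrow> bool" where
  "volume_condition V \<longleftrightarrow>
    (\<exists>A\<ge>1. \<exists>c1<1. \<forall>r\<ge>1. V r \<le> c1 * V (r + A)) \<and> comparable_on {1..} (\<lambda>r. V (r + 1)) V"

definition kernel_estimate ::
    "real \<Rightarrow> (real \<Rightarrow> real) \<Rightarrow> (real \<Rightarrow> 'e::metric_space \<Rightarrow> 'e \<Rightarrow> real) \<Rightarrow> bool" where
  "kernel_estimate \<alpha> V p \<longleftrightarrow>
    (\<forall>M>0. comparable_on
      {(t, x, y). 0 < t \<and> dist x y > M * t powr (2 / \<alpha>) \<and> dist x y > 1}
      (\<lambda>(t, x, y). p t x y)
      (\<lambda>(t, x, y). t * dist x y powr (- 1 - \<alpha> / 2) / V (dist x y)))"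

text \<open>The infimum of the empty set is \<^term>\<open>\<infinity> :: ennreal\<close>.\<close>

definition exit_time :: "(real \<Rightarrow> 'w \<Rightarrow> 'e) \<Rightarrow> 'e set \<Rightarrow> 'w \<Rightarrow> ennreal" where
  "exit_time X D \<omega> = Inf {ennreal t | t. 0 \<le> t \<and> X t \<omega> \<notin> D}"

text \<open>By the debut theorem the exit time of a right-continuous process is in general measurable
  only with respect to the completed sigma-algebra, hence the completion. The expectation is an
  extended nonnegative number, so that its finiteness is not presupposed.\<close>

definition expected_exit_time ::
    "(real \<Rightarrow> 'w \<Rightarrow> 'e) \<Rightarrow> ('e \<Rightarrow> 'w measure) \<Rightarrow> 'e \<Rightarrow> 'e set \<Rightarrow> ennreal" where
  "expected_exit_time X P y D = (\<integral>\<^sup>+\<omega>. exit_time X D \<omega> \<partial>completion (P y))"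

end

theory Submission
  imports Defs
begin

text \<open>Summing (K) over shells \<open>ball x (s (Suc k)) - ball x (s k)\<close>, where (V) controls the measure of
  a shell, gives tails of the transition probabilities of order \<open>t * \<rho> powr (- \<alpha> / 2)\<close> from above
  for \<open>\<rho> \<ge> 2\<close>, and from below for \<open>\<rho> = 2 * r\<close> at time \<open>r powr (\<alpha> / 2)\<close>.
  By the lower bound the process leaves \<open>ball x r\<close> within each time step \<open>r powr (\<alpha> / 2)\<close> with
  probability bounded away from zero, so the number of steps before the exit has geometric tails.

  For the lower bound on the exit time of a large ball, a process that leaves the ball before time
  \<open>T\<close> is with probability at least \<open>1 / 2\<close> still far from \<open>x\<close> at time \<open>T\<close>, which the upper tail makes
  unlikely. This fails for \<open>r\<close> close to 1, because (K) says nothing about displacements of size at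
  most 1. There, a last exit decomposition and the symmetry of the kernel bound the probability
  of hitting \<open>ball x 4 - cball x 1\<close> before time \<open>T\<close> by a multiple of \<open>T\<close>.

  The hitting probabilities are taken along finite time grids, where only the Markov property at
  constant times enters; right continuity passes to the limit of dyadic grids.\<close>

section \<open>Transition operators\<close>

context strong_markov_process
begin

text \<open>An expectation under the process instead of an integral against \<open>p\<close>, so
  that time 0 is included and the semigroup identity holds at every starting point, not only almost
  everywhere.\<close>

definition transition :: "real \<Rightarrow> ('e \<Rightarrow> ennreal) \<Rightarrow> 'e \<Rightarrow> ennreal" where
  "transition t f x = (\<integral>\<^sup>+\<omega>. f (X t \<omega>) \<partial>P x)"

lemma space_P: "space (P x) = space M"
  using sets_P by (rule sets_eq_imp_space_eq)

lemma sets_F_subset: "A \<in> sets (F s) \<Longrightarrow> A \<in> sets M"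
  using subalgebra_F by (auto simp: subalgebra_def)

lemma measurable_X [measurable]:
  assumes "0 \<le> t"
  shows "X t \<in> M \<rightarrow>\<^sub>M borel" "X t \<in> P x \<rightarrow>\<^sub>M borel"
proof -
  show 1: "X t \<in> M \<rightarrow>\<^sub>M borel"
    by (rule measurable_from_subalg[OF subalgebra_F adapted[OF assms]])
  show "X t \<in> P x \<rightarrow>\<^sub>M borel"
    using 1 by (simp cong: measurable_cong_sets add: sets_P)
qed

lemma measurable_comp_X:
  assumes "0 \<le> t" "f \<in> borel_measurable borel"
  shows "(\<lambda>\<omega>. f (X t \<omega>)) \<in> borel_measurable (P x)"
  by (rule measurable_compose[OF measurable_X(2)[OF assms(1)] assms(2)])

lemma transition_eq_distr:
  assumes "0 \<le> t" "f \<in> borel_measurable borel"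
  shows "transition t f x = (\<integral>\<^sup>+y. f y \<partial>distr (P x) borel (X t))"
  using assms by (simp add: transition_def nn_integral_distr)

lemma transition_indicator:
  assumes "0 \<le> t" "B \<in> sets borel"
  shows "transition t (indicator B) x = emeasure (P x) {\<omega> \<in> space M. X t \<omega> \<in> B}"
proof -
  have "emeasure (P x) {\<omega> \<in> space M. X t \<omega> \<in> B} = emeasure (distr (P x) borel (X t)) B"
    using assms by (subst emeasure_distr) (auto simp: vimage_def space_P Int_def conj_commute)
  also have "\<dots> = transition t (indicator B) x"
    using assms by (simp add: transition_eq_distr)
  finally show ?thesis ..
qed

lemma transition_measurable [measurable]:
  assumes "0 \<le> t" "f \<in> borel_measurable borel"
  shows "transition t f \<in> borel_measurable borel"
proof -
  \<comment> \<open>\<open>measurable_start\<close> makes the law of \<open>X t\<close> a kernel in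
    the starting point, and integrals against a kernel are measurable.\<close>
  have "(\<lambda>x. distr (P x) borel (X t)) \<in> borel \<rightarrow>\<^sub>M subprob_algebra borel"
  proof (rule measurable_subprob_algebra)
    fix x
    interpret prob_space "P x" by (rule prob_space_P)
    show "subprob_space (distr (P x) borel (X t))"
      using assms by (intro prob_space_imp_subprob_space prob_space_distr) simp
  next
    fix A :: "'e set" assume A: "A \<in> sets borel"
    have "emeasure (distr (P x) borel (X t)) A
        = ennreal (measure (P x) {\<omega> \<in> space M. X t \<omega> \<in> A})" for x
    proof -
      interpret prob_space "P x" by (rule prob_space_P)
      show ?thesis using A assms
        by (subst emeasure_distr)
          (auto simp: vimage_def space_P Int_def conj_commute emeasure_eq_measure)
    qed
    then show "(\<lambda>x. emeasure (distr (P x) borel (X t)) A) \<in> borel_measurable borel"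
      using measurable_start[OF assms(1) A] by simp
  qed simp
  from nn_integral_measurable_subprob_algebra[OF assms(2)] this
  have "(\<lambda>x. \<integral>\<^sup>+y. f y \<partial>distr (P x) borel (X t)) \<in> borel_measurable borel"
    by (rule measurable_compose_rev)
  moreover have "transition t f = (\<lambda>x. \<integral>\<^sup>+y. f y \<partial>distr (P x) borel (X t))"
    using assms by (simp add: transition_eq_distr fun_eq_iff)
  ultimately show ?thesis by simp
qed

lemma transition_mono: "(\<And>y. f y \<le> g y) \<Longrightarrow> transition t f x \<le> transition t g x"
  unfolding transition_def by (intro nn_integral_mono)

lemma transition_add:
  assumes "0 \<le> t" "f \<in> borel_measurable borel" "g \<in> borel_measurable borel"
  shows "transition t (\<lambda>y. f y + g y) x = transition t f x + transition t g x"
  using assms unfolding transition_def by (intro nn_integral_add measurable_comp_X) auto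

lemma transition_cmult:
  assumes "0 \<le> t" "f \<in> borel_measurable borel"
  shows "transition t (\<lambda>y. c * f y) x = c * transition t f x"
  using assms unfolding transition_def by (intro nn_integral_cmult measurable_comp_X) auto

lemma transition_sum:
  assumes "0 \<le> t" "\<And>i. i \<in> I \<Longrightarrow> f i \<in> borel_measurable borel"
  shows "transition t (\<lambda>y. \<Sum>i\<in>I. f i y) x = (\<Sum>i\<in>I. transition t (f i) x)"
  using assms unfolding transition_def by (intro nn_integral_sum measurable_comp_X) auto

lemma transition_const: "transition t (\<lambda>_. c) x = c"
  using prob_space.emeasure_space_1[OF prob_space_P] by (simp add: transition_def)

lemma transition_0: "f \<in> borel_measurable borel \<Longrightarrow> transition 0 f x = f x"
  unfolding transition_def
  by (subst nn_integral_cong_AE[where v = "\<lambda>_. f x"])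
    (use normal[of x] prob_space.emeasure_space_1[OF prob_space_P] in auto)

text \<open>The strong Markov property at the constant stopping time \<open>s\<close>, integrated
  over an event \<open>L\<close> known at that time. In this form no conditional expectation enters
  the later arguments.\<close>

lemma markov_indicator:
  assumes "0 \<le> s" "0 \<le> t" "L \<in> sets (F (ennreal s))" "B \<in> sets borel"
  shows "(\<integral>\<^sup>+\<omega>. indicator L \<omega> * indicator B (X (s + t) \<omega>) \<partial>P x)
       = (\<integral>\<^sup>+\<omega>. indicator L \<omega> * transition t (indicator B) (X s \<omega>) \<partial>P x)"
proof -
  define T :: "'w \<Rightarrow> ennreal" where "T = (\<lambda>_. ennreal s)"
  define E where "E = {\<omega> \<in> space M. X (s + t) \<omega> \<in> B}"
  define q where "q y = measure (P y) {\<omega>' \<in> space M. X t \<omega>' \<in> B}" for y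
  interpret prob_space "P x" by (rule prob_space_P)
  have T: "stopping_time F T"
    by (simp add: T_def stopping_time_const)
  have sub: "subalgebra (P x) (pre_sigma T)"
    unfolding subalgebra_def
  proof (intro conjI subsetI)
    fix A assume "A \<in> sets (pre_sigma T)"
    from sets_pre_sigmaD[OF T this, of "ennreal s"] have "A \<in> sets (F (ennreal s))"
      by (simp add: T_def)
    then show "A \<in> sets (P x)" using sets_F_subset by (simp add: sets_P)
  qed (simp add: space_pre_sigma space_P)
  \<comment> \<open>For \<open>u\<close> below \<open>s\<close> the set in question is empty;
    otherwise it is \<open>L\<close>, which lies in \<open>F u\<close> because the filtration is
    increasing.\<close>
  have L: "L \<in> sets (pre_sigma T)"
  proof (rule sets_pre_sigmaI[OF T])
    fix u show "{\<omega> \<in> L. T \<omega> \<le> u} \<in> sets (F u)"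
      using sets_F_mono[of "ennreal s" u] assms(3) by (cases "ennreal s \<le> u") (auto simp: T_def)
  qed
  have LP: "L \<in> sets (P x)" using assms(3) sets_F_subset by (simp add: sets_P)
  have [measurable]: "E \<in> sets (P x)"
  proof -
    have "E = X (s + t) -` B \<inter> space (P x)" by (auto simp: E_def space_P)
    then show ?thesis using assms by (simp add: measurable_sets)
  qed
  have [measurable]: "q \<in> borel_measurable borel"
    unfolding q_def using measurable_start assms by simp
  have qle: "0 \<le> q y" "q y \<le> 1" for y
    by (auto simp: q_def prob_space.prob_le_1[OF prob_space_P])
  interpret sub: finite_measure_subalgebra "P x" "pre_sigma T"
    by unfold_locales (rule sub)
  have int: "integrable (P x) (indicator E :: _ \<Rightarrow> real)"
    by (rule integrable_real_indicator) (auto simp: emeasure_eq_measure)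
  have Xs: "X s \<in> P x \<rightarrow>\<^sub>M borel" using assms by simp
  have qX [measurable]: "(\<lambda>\<omega>. q (X s \<omega>)) \<in> borel_measurable (P x)"
    using Xs by measurable
  note LP [measurable]
  have ae: "AE \<omega> in P x. real_cond_exp (P x) (pre_sigma T) (indicator E) \<omega> = q (X s \<omega>)"
    using strong_markov[OF T assms(2,4), of x] assms(1)
    by (simp add: T_def E_def q_def)
  have "(\<integral>\<omega>\<in>L. indicator E \<omega> \<partial>P x)
      = (\<integral>\<omega>\<in>L. real_cond_exp (P x) (pre_sigma T) (indicator E) \<omega> \<partial>P x)"
    by (rule sub.real_cond_exp_intA[OF int L])
  also have "\<dots> = (\<integral>\<omega>\<in>L. q (X s \<omega>) \<partial>P x)"
    by (rule set_lebesgue_integral_cong_AE) (use ae in auto)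
  finally have eq: "(\<integral>\<omega>. indicator L \<omega> * indicator E \<omega> \<partial>P x) = (\<integral>\<omega>. indicator L \<omega> * q (X s \<omega>) \<partial>P x)"
    by (simp add: set_lebesgue_integral_def)
  have i1: "integrable (P x) (\<lambda>\<omega>. indicator L \<omega> * indicator E \<omega> :: real)"
    by (rule integrable_const_bound[where B=1]) (auto simp: indicator_def)
  have i2: "integrable (P x) (\<lambda>\<omega>. indicator L \<omega> * q (X s \<omega>))"
    by (rule integrable_const_bound[where B=1]) (auto simp: indicator_def qle)
  have "(\<integral>\<^sup>+\<omega>. indicator L \<omega> * indicator B (X (s + t) \<omega>) \<partial>P x)
      = (\<integral>\<^sup>+\<omega>. ennreal (indicator L \<omega> * indicator E \<omega>) \<partial>P x)"
    by (intro nn_integral_cong) (auto simp: indicator_def E_def space_P)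
  also have "\<dots> = ennreal (\<integral>\<omega>. indicator L \<omega> * indicator E \<omega> \<partial>P x)"
    by (rule nn_integral_eq_integral[OF i1]) auto
  also have "\<dots> = ennreal (\<integral>\<omega>. indicator L \<omega> * q (X s \<omega>) \<partial>P x)" by (simp add: eq)
  also have "\<dots> = (\<integral>\<^sup>+\<omega>. ennreal (indicator L \<omega> * q (X s \<omega>)) \<partial>P x)"
    by (rule nn_integral_eq_integral[OF i2, symmetric]) (auto simp: qle)
  also have "\<dots> = (\<integral>\<^sup>+\<omega>. indicator L \<omega> * transition t (indicator B) (X s \<omega>) \<partial>P x)"
  proof (intro nn_integral_cong)
    fix \<omega>
    interpret Q: prob_space "P (X s \<omega>)" by (rule prob_space_P)
    show "ennreal (indicator L \<omega> * q (X s \<omega>)) = indicator L \<omega> * transition t (indicator B) (X s \<omega>)"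
      using assms by (auto simp: transition_indicator q_def Q.emeasure_eq_measure indicator_def)
  qed
  finally show ?thesis .
qed

text \<open>Extension from indicators to nonnegative Borel functions: both sides respect multiples,
  sums and increasing limits.\<close>

lemma markov_property:
  assumes "0 \<le> s" "0 \<le> t" "L \<in> sets (F (ennreal s))" "f \<in> borel_measurable borel"
  shows "(\<integral>\<^sup>+\<omega>. indicator L \<omega> * f (X (s + t) \<omega>) \<partial>P x)
       = (\<integral>\<^sup>+\<omega>. indicator L \<omega> * transition t f (X s \<omega>) \<partial>P x)"
proof -
  have [measurable]: "L \<in> sets (P x)" using assms(3) sets_F_subset by (simp add: sets_P)
  have [measurable]: "X s \<in> P x \<rightarrow>\<^sub>M borel" "X t \<in> P y \<rightarrow>\<^sub>M borel" "X (s + t) \<in> P x \<rightarrow>\<^sub>M borel" for y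
    using assms by auto
  show ?thesis
    using assms(4)
  proof (induction rule: borel_measurable_induct)
    case (cong f g)
    then have "f = g" by auto
    with cong show ?case by simp
  next
    case (set A)
    then show ?case using markov_indicator assms by simp
  next
    case (mult u c)
    note [measurable] = mult(2)
    have [measurable]: "transition t u \<in> borel_measurable borel" using assms mult by simp
    show ?case
      using mult assms by (simp add: transition_cmult nn_integral_cmult mult.left_commute[of _ c])
  next
    case (add u v)
    note [measurable] = add(1,4)
    have [measurable]: "transition t u \<in> borel_measurable borel" "transition t v \<in> borel_measurable borel"
      using assms add by simp_all
    show ?case
      using add assms by (simp add: transition_add nn_integral_add distrib_left)
  next
    case (seq U)
    note [measurable] = seq(1)
    have [measurable]: "transition t (U i) \<in> borel_measurable borel" for i using assms seq by simp
    have 1: "transition t (\<Squnion> range U) y = (SUP i. transition t (U i) y)" for y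
      unfolding transition_def SUP_apply
      by (rule nn_integral_monotone_convergence_SUP) (use seq in \<open>auto simp: incseq_def le_fun_def\<close>)
    have mono: "incseq (\<lambda>i. transition t (U i) y)" for y
      using seq(3) by (auto simp: incseq_def le_fun_def intro!: transition_mono)
    have "(\<integral>\<^sup>+\<omega>. indicator L \<omega> * (\<Squnion> range U) (X (s + t) \<omega>) \<partial>P x)
        = (\<integral>\<^sup>+\<omega>. (SUP i. indicator L \<omega> * U i (X (s + t) \<omega>)) \<partial>P x)"
      by (simp only: SUP_apply SUP_mult_left_ennreal)
    also have "\<dots> = (SUP i. \<integral>\<^sup>+\<omega>. indicator L \<omega> * U i (X (s + t) \<omega>) \<partial>P x)"
      by (rule nn_integral_monotone_convergence_SUP)
        (use seq in \<open>auto simp: incseq_def le_fun_def intro!: mult_left_mono\<close>)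
    also have "\<dots> = (SUP i. \<integral>\<^sup>+\<omega>. indicator L \<omega> * transition t (U i) (X s \<omega>) \<partial>P x)"
      using seq by simp
    also have "\<dots> = (\<integral>\<^sup>+\<omega>. (SUP i. indicator L \<omega> * transition t (U i) (X s \<omega>)) \<partial>P x)"
      by (rule nn_integral_monotone_convergence_SUP[symmetric])
        (use mono in \<open>auto simp: incseq_def le_fun_def intro!: mult_left_mono\<close>)
    also have "\<dots> = (\<integral>\<^sup>+\<omega>. indicator L \<omega> * transition t (\<Squnion> range U) (X s \<omega>) \<partial>P x)"
      by (simp only: SUP_mult_left_ennreal 1)
    finally show ?case .
  qed
qed

text \<open>The Markov property with the whole space as the event \<open>L\<close>.\<close>

lemma transition_transition:
  assumes "0 \<le> s" "0 \<le> t" "f \<in> borel_measurable borel"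
  shows "transition s (transition t f) x = transition (s + t) f x"
proof -
  have "(\<integral>\<^sup>+\<omega>. f (X (s + t) \<omega>) \<partial>P x)
      = (\<integral>\<^sup>+\<omega>. indicator (space M) \<omega> * f (X (s + t) \<omega>) \<partial>P x)"
    by (intro nn_integral_cong) (auto simp: space_P)
  also have "\<dots> = (\<integral>\<^sup>+\<omega>. indicator (space M) \<omega> * transition t f (X s \<omega>) \<partial>P x)"
    using sets.top[of "F (ennreal s)"] by (intro markov_property assms) (simp add: space_F)
  also have "\<dots> = (\<integral>\<^sup>+\<omega>. transition t f (X s \<omega>) \<partial>P x)"
    by (intro nn_integral_cong) (auto simp: space_P)
  finally show ?thesis by (simp add: transition_def)
qed

section \<open>The process killed along a time grid\<close>

text \<open>One step of the chain observed at multiples of \<open>h\<close> and killed upon landing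
  outside \<open>C\<close>. Only the point after the step is tested, never the starting point;
  \<open>stay\<close> and \<open>hit\<close> follow the same convention.\<close>

definition killed :: "'e set \<Rightarrow> real \<Rightarrow> ('e \<Rightarrow> ennreal) \<Rightarrow> 'e \<Rightarrow> ennreal" where
  "killed C h f = transition h (\<lambda>y. indicator C y * f y)"

definition stay :: "'e set \<Rightarrow> real \<Rightarrow> nat \<Rightarrow> 'w set" where
  "stay C h n = {\<omega> \<in> space M. \<forall>k\<in>{1..n}. X (real k * h) \<omega> \<in> C}"

text \<open>The \<open>k\<close>-th summand is the probability that the first visit to
  \<open>A\<close> at a positive grid time happens at step \<open>k + 1\<close>. Time reversal
  produces exactly such summands.\<close>

definition hit :: "'e set \<Rightarrow> real \<Rightarrow> nat \<Rightarrow> 'e \<Rightarrow> ennreal" where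
  "hit A h n y = (\<Sum>k<n. (killed (- A) h ^^ k) (transition h (indicator A)) y)"

lemma killed_measurable [measurable]:
  assumes "0 \<le> h" "C \<in> sets borel" "f \<in> borel_measurable borel"
  shows "(killed C h ^^ n) f \<in> borel_measurable borel"
  using assms(3)
proof (induction n)
  case (Suc n)
  note [measurable] = Suc.IH[OF Suc.prems] assms(2)
  show ?case using assms(1) by (simp add: killed_def[of C h "(_ ^^ _) _", abs_def] transition_measurable)
qed simp

lemma stay_sets:
  assumes "0 \<le> h" "C \<in> sets borel"
  shows "stay C h n \<in> sets (F (ennreal (real n * h)))"
proof -
  have "{\<omega> \<in> space M. X (real k * h) \<omega> \<in> C} \<in> sets (F (ennreal (real n * h)))"
    if "k \<in> {1..n}" for k
  proof -
    have "X (real k * h) -` C \<inter> space (F (ennreal (real k * h))) \<in> sets (F (ennreal (real k * h)))"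
      using assms by (intro measurable_sets[OF adapted]) auto
    moreover have "sets (F (ennreal (real k * h))) \<subseteq> sets (F (ennreal (real n * h)))"
      using that assms by (intro sets_F_mono ennreal_leI mult_right_mono) auto
    moreover have "X (real k * h) -` C \<inter> space (F (ennreal (real k * h)))
        = {\<omega> \<in> space M. X (real k * h) \<omega> \<in> C}"
      by (auto simp: space_F)
    ultimately show ?thesis by auto
  qed
  then have "{\<omega> \<in> space (F (ennreal (real n * h))). \<forall>k\<in>{1..n}. X (real k * h) \<omega> \<in> C}
      \<in> sets (F (ennreal (real n * h)))"
    by (intro sets.sets_Collect_finite_All) (auto simp: space_F)
  then show ?thesis by (simp add: stay_def space_F)
qed

lemma stay_sets_P: "0 \<le> h \<Longrightarrow> C \<in> sets borel \<Longrightarrow> stay C h n \<in> sets (P x)"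
  using stay_sets sets_F_subset by (auto simp: sets_P)

text \<open>The event \<open>stay C h n\<close> is known at time \<open>n * h\<close>, so the Markov
  property at that time turns the last step into one application of \<open>killed\<close>.\<close>

lemma killed_eq_stay:
  assumes "0 \<le> h" "C \<in> sets borel" "f \<in> borel_measurable borel"
  shows "(\<integral>\<^sup>+\<omega>. indicator (stay C h n) \<omega> * f (X (real n * h) \<omega>) \<partial>P x) = (killed C h ^^ n) f x"
  using assms(3)
proof (induction n arbitrary: f)
  case 0
  have "(\<integral>\<^sup>+\<omega>. indicator (stay C h 0) \<omega> * f (X (real 0 * h) \<omega>) \<partial>P x) = transition 0 f x"
    unfolding transition_def by (intro nn_integral_cong) (auto simp: stay_def space_P)
  then show ?case using 0 by (simp add: transition_0)
next
  case (Suc n)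
  note [measurable] = Suc.prems assms(2)
  have k: "killed C h f \<in> borel_measurable borel"
    using killed_measurable[OF assms(1,2) Suc.prems, where n = 1] by simp
  have "(\<integral>\<^sup>+\<omega>. indicator (stay C h (Suc n)) \<omega> * f (X (real (Suc n) * h) \<omega>) \<partial>P x)
      = (\<integral>\<^sup>+\<omega>. indicator (stay C h n) \<omega> *
          (\<lambda>y. indicator C y * f y) (X (real n * h + h) \<omega>) \<partial>P x)"
  proof (intro nn_integral_cong)
    fix \<omega>
    have "\<omega> \<in> stay C h (Suc n) \<longleftrightarrow> \<omega> \<in> stay C h n \<and> X (real (Suc n) * h) \<omega> \<in> C"
      by (auto simp: stay_def atLeastAtMostSuc_conv simp del: of_nat_Suc)
    moreover have "real (Suc n) * h = real n * h + h" by (simp add: algebra_simps)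
    ultimately show "indicator (stay C h (Suc n)) \<omega> * f (X (real (Suc n) * h) \<omega>)
        = indicator (stay C h n) \<omega> * (\<lambda>y. indicator C y * f y) (X (real n * h + h) \<omega>)"
      by (auto simp: indicator_def)
  qed
  also have "\<dots> = (\<integral>\<^sup>+\<omega>. indicator (stay C h n) \<omega> * killed C h f (X (real n * h) \<omega>) \<partial>P x)"
    unfolding killed_def using assms(1) by (intro markov_property stay_sets assms) auto
  also have "\<dots> = (killed C h ^^ n) (killed C h f) x"
    by (rule Suc.IH[OF k])
  finally show ?case by (simp add: funpow_swap1)
qed

lemma emeasure_stay:
  assumes "0 \<le> h" "C \<in> sets borel"
  shows "emeasure (P x) (stay C h n) = (killed C h ^^ n) (\<lambda>_. 1) x"
  using killed_eq_stay[OF assms, where f = "\<lambda>_. 1"] stay_sets_P[OF assms] by simp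

section \<open>Hitting probabilities along a time grid: first and last visits\<close>

lemma hit_measurable [measurable]:
  assumes "0 \<le> h" "A \<in> sets borel"
  shows "hit A h n \<in> borel_measurable borel"
proof -
  have "- A \<in> sets borel" using assms by simp
  from killed_measurable[OF assms(1) this] show ?thesis
    unfolding hit_def[abs_def] using assms by (intro borel_measurable_sum) simp
qed

text \<open>First step analysis: after one step the chain is in \<open>A\<close>, or it goes on from
  its new position with \<open>n\<close> steps left.\<close>

lemma hit_Suc:
  assumes "0 \<le> h" "A \<in> sets borel"
  shows "hit A h (Suc n) y = transition h (\<lambda>z. indicator A z + indicator (- A) z * hit A h n z) y"
proof -
  have C: "- A \<in> sets borel" using assms by simp
  note m = killed_measurable[OF assms(1) C, where f = "transition h (indicator A)"]
  have m' [measurable]: "(killed (- A) h ^^ k) (transition h (indicator A)) \<in> borel_measurable borel" for k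
    using assms by (intro m) simp
  note [measurable] = assms(2) C
  have h [measurable]: "hit A h n \<in> borel_measurable borel" using assms by (rule hit_measurable)
  have "hit A h (Suc n) y = transition h (indicator A) y
      + (\<Sum>k<n. transition h (\<lambda>z. indicator (- A) z * (killed (- A) h ^^ k) (transition h (indicator A)) z) y)"
    unfolding hit_def by (subst sum.lessThan_Suc_shift) (simp add: killed_def[of "- A" h "(_ ^^ _) _"])
  also have "\<dots> = transition h (indicator A) y + transition h (\<lambda>z. indicator (- A) z * hit A h n z) y"
    unfolding hit_def sum_distrib_left using assms(1) by (subst transition_sum) auto
  also have "\<dots> = transition h (\<lambda>z. indicator A z + indicator (- A) z * hit A h n z) y"
    using assms(1) by (subst transition_add) auto
  finally show ?thesis .
qed

lemma hit_0 [simp]: "hit A h 0 y = 0"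
  by (simp add: hit_def)

text \<open>Both terms obey a first step recursion, and by induction the functions under
  \<open>transition h\<close> add up to 1 at every point.\<close>

lemma hit_add_stay:
  assumes "0 \<le> h" "A \<in> sets borel"
  shows "hit A h n y + (killed (- A) h ^^ n) (\<lambda>_. 1) y = 1"
proof (induction n arbitrary: y)
  case (Suc n)
  have C [measurable]: "- A \<in> sets borel" using assms by simp
  note [measurable] = assms(2) killed_measurable[OF assms(1) C, where f = "\<lambda>_. 1" and n = n] hit_measurable[OF assms, of n]
  have "hit A h (Suc n) y + (killed (- A) h ^^ Suc n) (\<lambda>_. 1) y
     = transition h (\<lambda>z. (indicator A z + indicator (- A) z * hit A h n z)
        + indicator (- A) z * (killed (- A) h ^^ n) (\<lambda>_. 1) z) y"
    using assms(1) by (subst transition_add) (auto simp: hit_Suc[OF assms] killed_def)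
  also have "(\<lambda>z. (indicator A z + indicator (- A) z * hit A h n z)
        + indicator (- A) z * (killed (- A) h ^^ n) (\<lambda>_. 1) z) = (\<lambda>_. 1)"
    using Suc.IH by (auto simp: fun_eq_iff indicator_def)
  finally show ?case by (simp add: transition_const)
qed simp

text \<open>The complementary event is that of staying in \<open>- A\<close>, whose probability
  \<open>hit_add_stay\<close> relates to \<open>hit\<close>.\<close>

lemma emeasure_hit:
  assumes "0 \<le> h" "A \<in> sets borel"
  shows "emeasure (P x) {\<omega> \<in> space M. \<exists>k\<in>{1..n}. X (real k * h) \<omega> \<in> A} = hit A h n x"
proof -
  interpret prob_space "P x" by (rule prob_space_P)
  have C: "- A \<in> sets borel" using assms by simp
  have "{\<omega> \<in> space M. \<exists>k\<in>{1..n}. X (real k * h) \<omega> \<in> A} = space (P x) - stay (- A) h n"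
    by (auto simp: stay_def space_P)
  then have "emeasure (P x) {\<omega> \<in> space M. \<exists>k\<in>{1..n}. X (real k * h) \<omega> \<in> A}
      = 1 - emeasure (P x) (stay (- A) h n)"
    using stay_sets_P[OF assms(1) C] by (simp add: emeasure_compl emeasure_space_1)
  also have "\<dots> = (hit A h n x + emeasure (P x) (stay (- A) h n)) - emeasure (P x) (stay (- A) h n)"
    using hit_add_stay[OF assms, of n x] by (simp add: emeasure_stay[OF assms(1) C])
  also have "\<dots> = hit A h n x"
    by (intro ennreal_add_diff_cancel_right) simp
  finally show ?thesis .
qed

text \<open>A discrete strong Markov property at the first visit to \<open>A\<close>: from the
  visited point, with \<open>j < n\<close> steps left, the chain ends in \<open>D\<close> with
  probability at least \<open>\<theta>\<close>. The induction over first steps avoids handling the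
  random time itself.\<close>

lemma first_passage:
  assumes "0 \<le> h" "A \<in> sets borel" "D \<in> sets borel"
    and ret: "\<And>a j. a \<in> A \<Longrightarrow> j < n \<Longrightarrow> \<theta> \<le> transition (real j * h) (indicator D) a"
  shows "\<theta> * hit A h n y \<le> transition (real n * h) (indicator D) y"
  using ret
proof (induction n arbitrary: y)
  case (Suc n)
  have C [measurable]: "- A \<in> sets borel" using assms by simp
  note [measurable] = assms(2) hit_measurable[OF assms(1,2), of n]
  have "\<theta> * hit A h (Suc n) y
      = transition h (\<lambda>z. \<theta> * (indicator A z + indicator (- A) z * hit A h n z)) y"
    using assms(1) by (subst transition_cmult) (auto simp: hit_Suc[OF assms(1,2)])
  also have "\<dots> \<le> transition h (transition (real n * h) (indicator D)) y"
  proof (rule transition_mono)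
    fix z show "\<theta> * (indicator A z + indicator (- A) z * hit A h n z) \<le> transition (real n * h) (indicator D) z"
      using Suc by (cases "z \<in> A") auto
  qed
  also have "\<dots> = transition (h + real n * h) (indicator D) y"
    using assms by (intro transition_transition) auto
  finally show ?case by (simp add: algebra_simps)
qed simp

text \<open>Splits according to the last visit to \<open>A\<close>: it happens at step
  \<open>k + 1\<close>, and the remaining \<open>n - Suc k\<close> steps avoid
  \<open>A\<close>.\<close>

lemma last_exit:
  assumes "0 \<le> h" "A \<in> sets borel"
  shows "hit A h n x = (\<Sum>k<n. transition (real (Suc k) * h)
           (\<lambda>y. indicator A y * (killed (- A) h ^^ (n - Suc k)) (\<lambda>_. 1) y) x)"
proof -
  let ?S = "\<lambda>m. (killed (- A) h ^^ m) (\<lambda>_. 1)"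
  define R where "R m = (\<lambda>y. indicator A y * ?S m y)" for m
  have C [measurable]: "- A \<in> sets borel" using assms by simp
  note [measurable] = assms(2) killed_measurable[OF assms(1) C, where f = "\<lambda>_. 1"]
  have R [measurable]: "R m \<in> borel_measurable borel" for m unfolding R_def by measurable
  \<comment> \<open>Total probability: there is a last visit to \<open>A\<close>, or there is no
    visit at all.\<close>
  have *: "(\<Sum>k<n. transition (real (Suc k) * h) (R (n - Suc k)) x) + ?S n x = 1" for n x
  proof (induction n arbitrary: x)
    case (Suc n)
    have shift: "transition (real (Suc (Suc k)) * h) f x
        = transition h (transition (real (Suc k) * h) f) x" if "f \<in> borel_measurable borel" for k f
      using assms(1) that by (subst transition_transition) (auto simp: algebra_simps)
    \<comment> \<open>A last visit at step 1 and no visit at all differ only in where the first step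
      lands; together they say that the \<open>n\<close> later steps avoid \<open>A\<close>.\<close>
    have "transition h (R n) x + ?S (Suc n) x = transition h (\<lambda>y. R n y + indicator (- A) y * ?S n y) x"
      using assms(1) by (subst transition_add) (auto simp: killed_def)
    also have "(\<lambda>y. R n y + indicator (- A) y * ?S n y) = ?S n"
      by (auto simp: R_def fun_eq_iff indicator_def)
    finally have one: "transition h (R n) x + ?S (Suc n) x = transition h (?S n) x" .
    have "(\<Sum>k<Suc n. transition (real (Suc k) * h) (R (Suc n - Suc k)) x) + ?S (Suc n) x
       = (transition h (R n) x + (\<Sum>k<n. transition (real (Suc (Suc k)) * h) (R (n - Suc k)) x)) + ?S (Suc n) x"
      by (subst sum.lessThan_Suc_shift) simp
    also have "\<dots> = (\<Sum>k<n. transition h (transition (real (Suc k) * h) (R (n - Suc k))) x)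
         + (transition h (R n) x + ?S (Suc n) x)"
      by (simp only: shift[OF R]) (simp only: ac_simps)
    also have "\<dots> = transition h (\<lambda>y. (\<Sum>k<n. transition (real (Suc k) * h) (R (n - Suc k)) y) + ?S n y) x"
      unfolding one using assms(1) by (subst transition_add) (auto simp: transition_sum)
    also have "\<dots> = 1" by (simp only: Suc.IH transition_const)
    finally show ?case .
  qed simp
  have "?S n x + hit A h n x = ?S n x + (\<Sum>k<n. transition (real (Suc k) * h) (R (n - Suc k)) x)"
    using *[of n x] hit_add_stay[OF assms, of n x] by (simp only: add.commute)
  \<comment> \<open>Cancellation in \<open>ennreal\<close> needs a finite summand.\<close>
  moreover have "?S n x \<noteq> \<top>"
    using hit_add_stay[OF assms, of n x] by (auto simp: ennreal_one_neq_top)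
  ultimately show ?thesis
    by (simp only: ennreal_add_left_cancel R_def infinity_ennreal_def) simp
qed

end

section \<open>Symmetry\<close>

locale markov_heat_kernel =
  heat_kernel \<mu> p + strong_markov_process M F X P
  for \<mu> :: "'e::metric_space measure" and p :: "real \<Rightarrow> 'e \<Rightarrow> 'e \<Rightarrow> real"
    and M :: "'w measure" and F and X :: "real \<Rightarrow> 'w \<Rightarrow> 'e" and P +
  fixes V :: "real \<Rightarrow> real"
  assumes transition_density: "has_transition_density M X P \<mu> p"
    and volume: "volume_growth \<mu> V"
begin

section \<open>Volumes of balls and the passage from the process to its kernel\<close>

lemma volume_pos: "0 < r \<Longrightarrow> 0 < V r"
  and emeasure_ball: "0 < r \<Longrightarrow> emeasure \<mu> (ball x r) = ennreal (V r)"
  using volume by (auto simp: volume_growth_def)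

lemma space_mu: "space \<mu> = UNIV"
  using sets_eq_imp_space_eq[OF sets_mu] by simp

lemma borel_mu: "borel_measurable \<mu> = borel_measurable borel"
  by (rule measurable_cong_sets) (simp_all add: sets_mu)

text \<open>Homogeneity gives every ball finite measure. Sigma-finiteness is what Fubini requires in
  \<open>transition_symmetric\<close>.\<close>

lemma sigma_finite_mu: "sigma_finite_measure \<mu>"
proof
  let ?A = "range (\<lambda>n::nat. ball undefined (real n + 1))"
  have "\<Union>?A = (UNIV :: 'e set)"
  proof (intro set_eqI iffI UNIV_I)
    fix y :: 'e
    obtain n :: nat where "dist undefined y < real n" using reals_Archimedean2 by blast
    then have "y \<in> ball undefined (real n + 1)" by simp
    then show "y \<in> \<Union>?A" by blast
  qed
  then show "\<exists>A. countable A \<and> A \<subseteq> sets \<mu> \<and> \<Union>A = space \<mu> \<and> (\<forall>a\<in>A. emeasure \<mu> a \<noteq> \<infinity>)"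
    by (intro exI[of _ ?A]) (auto simp: sets_mu space_mu emeasure_ball)
qed

lemma kernel_measurable:
  assumes "0 < t"
  shows "(\<lambda>y. ennreal (p t x y)) \<in> borel_measurable borel"
proof -
  have "(\<lambda>y. (\<lambda>(x, y). p t x y) (x, y)) \<in> borel_measurable \<mu>"
    by (rule measurable_compose[OF measurable_Pair1' measurable[OF assms]]) (simp add: space_mu)
  then show ?thesis by (simp add: borel_mu)
qed

lemma transition_eq:
  assumes "0 < t" "f \<in> borel_measurable borel"
  shows "transition t f x = (\<integral>\<^sup>+y. ennreal (p t x y) * f y \<partial>\<mu>)"
proof -
  have "distr (P x) borel (X t) = density \<mu> (\<lambda>y. ennreal (p t x y))"
  proof (rule measure_eqI)
    fix B assume "B \<in> sets (distr (P x) borel (X t))"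
    then have B: "B \<in> sets borel" by simp
    have "emeasure (distr (P x) borel (X t)) B = emeasure (P x) {\<omega> \<in> space M. X t \<omega> \<in> B}"
      using assms B by (subst emeasure_distr) (auto simp: vimage_def space_P Int_def conj_commute)
    also have "\<dots> = (\<integral>\<^sup>+y\<in>B. ennreal (p t x y) \<partial>\<mu>)"
      using transition_density assms B by (simp add: has_transition_density_def)
    also have "\<dots> = emeasure (density \<mu> (\<lambda>y. ennreal (p t x y))) B"
      using B kernel_measurable[OF assms(1)] by (subst emeasure_density) (auto simp: sets_mu borel_mu)
    finally show "emeasure (distr (P x) borel (X t)) B = emeasure (density \<mu> (\<lambda>y. ennreal (p t x y))) B" .
  qed (simp add: sets_mu)
  then show ?thesis
    using assms kernel_measurable[OF assms(1)]
    by (simp add: transition_eq_distr nn_integral_density borel_mu)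
qed

text \<open>Self-adjointness with respect to \<open>\<mu>\<close>. The kernel is symmetric only
  almost everywhere on the product, which is enough once Fubini has produced a double
  integral.\<close>

lemma transition_symmetric:
  assumes "0 < t" "f \<in> borel_measurable borel" "g \<in> borel_measurable borel"
  shows "(\<integral>\<^sup>+x. f x * transition t g x \<partial>\<mu>) = (\<integral>\<^sup>+x. transition t f x * g x \<partial>\<mu>)"
proof -
  interpret sigma_finite_measure \<mu> by (rule sigma_finite_mu)
  interpret pair_sigma_finite \<mu> \<mu> ..
  have [measurable]: "f \<in> borel_measurable \<mu>" "g \<in> borel_measurable \<mu>" using assms by (simp_all add: borel_mu)
  note [measurable] = measurable[OF assms(1)]
  have [measurable]: "(\<lambda>y. ennreal (p t x y)) \<in> borel_measurable \<mu>" for x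
    using kernel_measurable[OF assms(1)] by (simp add: borel_mu)
  have m2 [measurable]: "(\<lambda>(x, y). p t y x) \<in> borel_measurable (\<mu> \<Otimes>\<^sub>M \<mu>)"
    using measurable_pair_swap[OF measurable[OF assms(1)]] by simp
  have "(\<integral>\<^sup>+x. f x * transition t g x \<partial>\<mu>) = (\<integral>\<^sup>+x. (\<integral>\<^sup>+y. f x * (ennreal (p t x y) * g y) \<partial>\<mu>) \<partial>\<mu>)"
    using assms by (simp add: transition_eq nn_integral_cmult)
  also have "\<dots> = (\<integral>\<^sup>+z. (\<lambda>(x, y). f x * (ennreal (p t x y) * g y)) z \<partial>(\<mu> \<Otimes>\<^sub>M \<mu>))"
    by (subst sigma_finite_measure.nn_integral_fst[OF sigma_finite_mu, symmetric]) simp_all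
  also have "\<dots> = (\<integral>\<^sup>+z. (\<lambda>(x, y). f x * (ennreal (p t y x) * g y)) z \<partial>(\<mu> \<Otimes>\<^sub>M \<mu>))"
    by (rule nn_integral_cong_AE) (use symmetric[OF assms(1)] in auto)
  also have "\<dots> = (\<integral>\<^sup>+y. (\<integral>\<^sup>+x. f x * (ennreal (p t y x) * g y) \<partial>\<mu>) \<partial>\<mu>)"
    by (subst nn_integral_snd[symmetric]) simp_all
  also have "\<dots> = (\<integral>\<^sup>+y. (\<integral>\<^sup>+x. ennreal (p t y x) * f x \<partial>\<mu>) * g y \<partial>\<mu>)"
    by (intro nn_integral_cong) (subst nn_integral_multc[symmetric], auto simp: ac_simps)
  also have "\<dots> = (\<integral>\<^sup>+x. transition t f x * g x \<partial>\<mu>)"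
    using assms by (simp add: transition_eq)
  finally show ?thesis .
qed

text \<open>With the indicator of \<open>C\<close> attached, the killed step is self-adjoint; the
  induction moves one step at a time from \<open>g\<close> to \<open>f\<close>.\<close>

lemma killed_symmetric:
  assumes "0 < h" "C \<in> sets borel" "f \<in> borel_measurable borel" "g \<in> borel_measurable borel"
  shows "(\<integral>\<^sup>+x. indicator C x * f x * (killed C h ^^ n) g x \<partial>\<mu>)
       = (\<integral>\<^sup>+x. (killed C h ^^ n) f x * (indicator C x * g x) \<partial>\<mu>)"
  using assms(3)
proof (induction n arbitrary: f)
  case 0
  then show ?case by (simp add: ac_simps)
next
  case (Suc n)
  note [measurable] = Suc.prems assms(2,4)
  have h: "0 \<le> h" using assms(1) by simp
  have g' [measurable]: "(killed C h ^^ n) g \<in> borel_measurable borel"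
    using h assms(2,4) by (rule killed_measurable)
  have f': "killed C h f \<in> borel_measurable borel"
    using killed_measurable[OF h assms(2) Suc.prems, where n = 1] by simp
  have "(\<integral>\<^sup>+x. indicator C x * f x * (killed C h ^^ Suc n) g x \<partial>\<mu>)
      = (\<integral>\<^sup>+x. indicator C x * f x * transition h (\<lambda>y. indicator C y * (killed C h ^^ n) g y) x \<partial>\<mu>)"
    by (simp add: killed_def[of C h "(_ ^^ _) _"])
  also have "\<dots> = (\<integral>\<^sup>+x. transition h (\<lambda>x. indicator C x * f x) x * (indicator C x * (killed C h ^^ n) g x) \<partial>\<mu>)"
    by (rule transition_symmetric[OF assms(1)]) auto
  also have "\<dots> = (\<integral>\<^sup>+x. indicator C x * killed C h f x * (killed C h ^^ n) g x \<partial>\<mu>)"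
    by (simp add: killed_def[of C h f] ac_simps)
  also have "\<dots> = (\<integral>\<^sup>+x. (killed C h ^^ n) (killed C h f) x * (indicator C x * g x) \<partial>\<mu>)"
    by (rule Suc.IH[OF f'])
  finally show ?case by (simp add: funpow_swap1)
qed

text \<open>A path that starts in \<open>A\<close> and avoids it for \<open>n + 1\<close> steps,
  read backwards, starts outside \<open>A\<close> and enters it for the first time at step
  \<open>n + 1\<close>. Symmetry gives both the same weight.\<close>

lemma stay_reversal:
  assumes "0 < h" "A \<in> sets borel"
  shows "(\<integral>\<^sup>+x. indicator A x * (killed (- A) h ^^ Suc n) (\<lambda>_. 1) x \<partial>\<mu>)
       = (\<integral>\<^sup>+x. (killed (- A) h ^^ n) (transition h (indicator A)) x * indicator (- A) x \<partial>\<mu>)"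
proof -
  have C [measurable]: "- A \<in> sets borel" using assms by simp
  have h: "0 \<le> h" using assms(1) by simp
  note [measurable] = assms(2)
  have S [measurable]: "(killed (- A) h ^^ n) (\<lambda>_. 1) \<in> borel_measurable borel"
    using h C by (rule killed_measurable) simp
  have "(\<integral>\<^sup>+x. indicator A x * (killed (- A) h ^^ Suc n) (\<lambda>_. 1) x \<partial>\<mu>)
      = (\<integral>\<^sup>+x. indicator A x * transition h (\<lambda>y. indicator (- A) y * (killed (- A) h ^^ n) (\<lambda>_. 1) y) x \<partial>\<mu>)"
    by (simp add: killed_def[of _ h "(_ ^^ _) _"])
  also have "\<dots> = (\<integral>\<^sup>+x. transition h (indicator A) x * (indicator (- A) x * (killed (- A) h ^^ n) (\<lambda>_. 1) x) \<partial>\<mu>)"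
    by (rule transition_symmetric[OF assms(1)]) auto
  also have "\<dots> = (\<integral>\<^sup>+x. indicator (- A) x * transition h (indicator A) x * (killed (- A) h ^^ n) (\<lambda>_. 1) x \<partial>\<mu>)"
    by (simp add: ac_simps)
  also have "\<dots> = (\<integral>\<^sup>+x. (killed (- A) h ^^ n) (transition h (indicator A)) x * (indicator (- A) x * 1) \<partial>\<mu>)"
    using h by (intro killed_symmetric[OF assms(1) C]) auto
  finally show ?thesis by simp
qed

text \<open>Integrates \<open>first_passage\<close> over the starting point. Since constants are
  preserved, symmetry makes \<open>\<mu>\<close> invariant, so the right-hand side integrates to the
  measure of \<open>D\<close>.\<close>

lemma nn_integral_hit_le:
  assumes "0 < h" "A \<in> sets borel" "D \<in> sets borel"
    and ret: "\<And>a j. a \<in> A \<Longrightarrow> j < n \<Longrightarrow> \<theta> \<le> transition (real j * h) (indicator D) a"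
  shows "\<theta> * (\<integral>\<^sup>+y. hit A h n y \<partial>\<mu>) \<le> emeasure \<mu> D"
proof (cases "n = 0")
  case False
  have h: "0 \<le> h" and nh: "0 < real n * h" using assms(1) False by simp_all
  have m: "hit A h n \<in> borel_measurable \<mu>" using h assms(2) by (simp add: borel_mu)
  have "\<theta> * (\<integral>\<^sup>+y. hit A h n y \<partial>\<mu>) = (\<integral>\<^sup>+y. \<theta> * hit A h n y \<partial>\<mu>)"
    using m by (simp add: nn_integral_cmult)
  also have "\<dots> \<le> (\<integral>\<^sup>+y. 1 * transition (real n * h) (indicator D) y \<partial>\<mu>)"
    unfolding mult_1 by (intro nn_integral_mono first_passage[OF h assms(2,3)] ret)
  also have "\<dots> = (\<integral>\<^sup>+y. transition (real n * h) (\<lambda>_. 1) y * indicator D y \<partial>\<mu>)"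
    by (rule transition_symmetric[OF nh]) (use assms in auto)
  also have "\<dots> = emeasure \<mu> D"
    using assms(3) by (simp add: transition_const sets_mu)
  finally show ?thesis .
qed simp

text \<open>A last exit decomposition expresses the hitting probability through the kernel on \<open>A\<close> and the
  probabilities of not returning to \<open>A\<close>. By time reversal the integrals over \<open>A\<close> of the latter sum to
  the measure of \<open>A\<close> plus the integral of the hitting probabilities, so no estimate of the kernel
  near the diagonal is needed.\<close>

lemma hit_le_of_kernel_le:
  assumes "0 < h" "A \<in> sets borel" "D \<in> sets borel"
    and ret: "\<And>a j. a \<in> A \<Longrightarrow> j < n \<Longrightarrow> \<theta> \<le> transition (real j * h) (indicator D) a"
    and K: "\<And>a k. a \<in> A \<Longrightarrow> k \<in> {1..n} \<Longrightarrow> ennreal (p (real k * h) x a) \<le> K"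
  shows "\<theta> * hit A h n x \<le> K * (\<theta> * emeasure \<mu> A + emeasure \<mu> D)"
proof -
  let ?S = "\<lambda>m. (killed (- A) h ^^ m) (\<lambda>_. 1)"
  let ?T = "\<lambda>m. (killed (- A) h ^^ m) (transition h (indicator A))"
  have C [measurable]: "- A \<in> sets borel" using assms by simp
  have h: "0 \<le> h" using assms(1) by simp
  have [measurable]: "A \<in> sets \<mu>" "- A \<in> sets \<mu>" using assms(2) C by (simp_all add: sets_mu)
  have S: "?S m \<in> borel_measurable borel" for m
    using h C by (rule killed_measurable) simp
  have S' [measurable]: "?S m \<in> borel_measurable \<mu>" for m using S by (simp add: borel_mu)
  have T [measurable]: "?T m \<in> borel_measurable \<mu>" for m
    unfolding borel_mu using h C by (rule killed_measurable) (use h assms in simp)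
  have AS: "(\<lambda>y. indicator A y * ?S m y) \<in> borel_measurable borel" for m
    using S[of m] assms(2) by measurable
  have "hit A h n x = (\<Sum>k<n. transition (real (Suc k) * h) (\<lambda>y. indicator A y * ?S (n - Suc k) y) x)"
    by (rule last_exit[OF h assms(2)])
  also have "\<dots> \<le> (\<Sum>k<n. K * (\<integral>\<^sup>+y. indicator A y * ?S (n - Suc k) y \<partial>\<mu>))"
  proof (rule sum_mono)
    fix k assume k: "k \<in> {..<n}"
    have "transition (real (Suc k) * h) (\<lambda>y. indicator A y * ?S (n - Suc k) y) x
        = (\<integral>\<^sup>+y. ennreal (p (real (Suc k) * h) x y) * (indicator A y * ?S (n - Suc k) y) \<partial>\<mu>)"
      using assms(1) by (intro transition_eq AS) simp
    also have "\<dots> \<le> (\<integral>\<^sup>+y. K * (indicator A y * ?S (n - Suc k) y) \<partial>\<mu>)"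
      using K[of _ "Suc k"] k by (intro nn_integral_mono) (auto simp: indicator_def intro!: mult_right_mono)
    also have "\<dots> = K * (\<integral>\<^sup>+y. indicator A y * ?S (n - Suc k) y \<partial>\<mu>)"
      by (rule nn_integral_cmult) simp
    finally show "transition (real (Suc k) * h) (\<lambda>y. indicator A y * ?S (n - Suc k) y) x
      \<le> K * (\<integral>\<^sup>+y. indicator A y * ?S (n - Suc k) y \<partial>\<mu>)" .
  qed
  also have "\<dots> = K * (\<Sum>m<n. \<integral>\<^sup>+y. indicator A y * ?S m y \<partial>\<mu>)"
    by (subst sum.nat_diff_reindex) (simp add: sum_distrib_left)
  \<comment> \<open>One more summand is added so that, after the term \<open>m = 0\<close> is split
    off as the measure of \<open>A\<close>, time reversal turns the rest into the \<open>n\<close>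
    summands of \<open>hit\<close>, integrated over the complement of \<open>A\<close>.\<close>
  also have "\<dots> \<le> K * (\<Sum>m<Suc n. \<integral>\<^sup>+y. indicator A y * ?S m y \<partial>\<mu>)"
    by (intro mult_left_mono sum_mono2) auto
  finally have *: "hit A h n x \<le> K * (\<Sum>m<Suc n. \<integral>\<^sup>+y. indicator A y * ?S m y \<partial>\<mu>)" .
  have "(\<Sum>m<Suc n. \<integral>\<^sup>+y. indicator A y * ?S m y \<partial>\<mu>)
      = emeasure \<mu> A + (\<Sum>m<n. \<integral>\<^sup>+y. ?T m y * indicator (- A) y \<partial>\<mu>)"
    by (subst sum.lessThan_Suc_shift) (simp only: stay_reversal[OF assms(1,2)], simp)
  also have "\<dots> \<le> emeasure \<mu> A + (\<Sum>m<n. \<integral>\<^sup>+y. ?T m y \<partial>\<mu>)"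
    by (intro add_left_mono sum_mono nn_integral_mono) (auto simp: indicator_def)
  also have "(\<Sum>m<n. \<integral>\<^sup>+y. ?T m y \<partial>\<mu>) = (\<integral>\<^sup>+y. hit A h n y \<partial>\<mu>)"
    unfolding hit_def by (subst nn_integral_sum) auto
  finally have "hit A h n x \<le> K * (emeasure \<mu> A + (\<integral>\<^sup>+y. hit A h n y \<partial>\<mu>))"
    using * by (meson mult_left_mono order_trans zero_le)
  then have "\<theta> * hit A h n x \<le> \<theta> * (K * (emeasure \<mu> A + (\<integral>\<^sup>+y. hit A h n y \<partial>\<mu>)))"
    by (rule mult_left_mono) simp
  also have "\<dots> = K * (\<theta> * emeasure \<mu> A + \<theta> * (\<integral>\<^sup>+y. hit A h n y \<partial>\<mu>))"
    by (simp add: ring_distribs ac_simps)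
  also have "\<dots> \<le> K * (\<theta> * emeasure \<mu> A + emeasure \<mu> D)"
    by (intro mult_left_mono add_left_mono nn_integral_hit_le[OF assms(1-3)] ret) auto
  finally show ?thesis .
qed

end

section \<open>Exit times and time grids\<close>

context strong_markov_process
begin

text \<open>Each grid step that ends in \<open>B\<close> costs a factor \<open>q\<close>, uniformly
  over its starting point in \<open>B\<close>.\<close>

lemma killed_power_le:
  assumes "0 \<le> h" "B \<in> sets borel" "\<And>z. z \<in> B \<Longrightarrow> transition h (indicator B) z \<le> q" "y \<in> B"
  shows "(killed B h ^^ n) (\<lambda>_. 1) y \<le> q ^ n"
  using assms(4)
proof (induction n arbitrary: y)
  case (Suc n)
  have "(killed B h ^^ Suc n) (\<lambda>_. 1) y \<le> transition h (\<lambda>z. q ^ n * indicator B z) y"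
    using Suc.IH by (auto simp: killed_def[of B h "(_ ^^ _) _"] indicator_def intro!: transition_mono)
  also have "\<dots> = q ^ n * transition h (indicator B) y"
    using assms by (intro transition_cmult) auto
  also have "\<dots> \<le> q ^ n * q"
    using Suc.prems by (intro mult_left_mono assms) auto
  finally show ?case by (simp add: ac_simps)
qed simp

text \<open>Rounds the exit time up to the grid. If \<open>stay B h N\<close> is the first of these
  events to fail, the exit has happened by time \<open>N * h\<close>, and the terms with
  \<open>n < N\<close>, including \<open>n = 0\<close>, already sum to this. If none fails, the
  series is infinite.\<close>

lemma exit_time_le_stay:
  assumes "0 < h" "\<omega> \<in> space M"
  shows "exit_time X B \<omega> \<le> (\<Sum>n. ennreal h * indicator (stay B h n) \<omega>)"
proof (cases "\<forall>n. \<omega> \<in> stay B h n")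
  case True
  have "ennreal (real N * h) \<le> (\<Sum>n. ennreal h)" for N
  proof -
    have "ennreal (real N * h) = (\<Sum>n<N. ennreal h)"
      using assms by (simp add: ennreal_mult ennreal_of_nat_eq_real_of_nat)
    also have "\<dots> \<le> (\<Sum>n. ennreal h)" by (rule sum_le_suminf) auto
    finally show ?thesis .
  qed
  moreover have False if "(\<Sum>n. ennreal h) = ennreal r" "0 \<le> r" "\<And>N. ennreal (real N * h) \<le> (\<Sum>n. ennreal h)" for r
  proof -
    obtain N :: nat where "r / h < real N" using reals_Archimedean2 by blast
    then have "r < real N * h" using assms by (simp add: field_simps)
    then show False using that(3)[of N] that(1,2) assms by (simp add: ennreal_le_iff)
  qed
  ultimately have "(\<Sum>n. ennreal h) = \<top>"
    by (cases "\<Sum>n. ennreal h") auto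
  then show ?thesis using True by simp
next
  case False
  define N where "N = (LEAST n. \<omega> \<notin> stay B h n)"
  have N: "\<omega> \<notin> stay B h N" and less: "n < N \<Longrightarrow> \<omega> \<in> stay B h n" for n
    using False LeastI_ex[of "\<lambda>n. \<omega> \<notin> stay B h n"] not_less_Least[of n "\<lambda>n. \<omega> \<notin> stay B h n"]
    by (auto simp: N_def)
  obtain k where k: "k \<in> {1..N}" "X (real k * h) \<omega> \<notin> B"
    using N assms by (auto simp: stay_def)
  have "exit_time X B \<omega> \<le> ennreal (real k * h)"
    unfolding exit_time_def using k assms by (intro Inf_lower) auto
  also have "\<dots> \<le> ennreal (real N * h)" using k assms by (intro ennreal_leI mult_right_mono) auto
  also have "\<dots> = (\<Sum>n<N. ennreal h * indicator (stay B h n) \<omega>)"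
    using assms less by (simp add: ennreal_mult ennreal_of_nat_eq_real_of_nat)
  also have "\<dots> \<le> (\<Sum>n. ennreal h * indicator (stay B h n) \<omega>)" by (rule sum_le_suminf) auto
  finally show ?thesis .
qed

text \<open>The survival probabilities \<open>q ^ n\<close> turn the series of
  \<open>exit_time_le_stay\<close> into a geometric one.\<close>

lemma expected_exit_time_le:
  assumes "0 < h" "B \<in> sets borel" "0 \<le> q" "q < 1" "y \<in> B"
    and "\<And>z. z \<in> B \<Longrightarrow> transition h (indicator B) z \<le> ennreal q"
  shows "expected_exit_time X P y B \<le> ennreal (h / (1 - q))"
proof -
  have h: "0 \<le> h" using assms(1) by simp
  note [measurable] = stay_sets_P[OF h assms(2)]
  \<comment> \<open>The nonnegative integral does not change under completion and is monotone for
    arbitrary functions, so the exit time can be estimated without proving it measurable.\<close>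
  have "expected_exit_time X P y B = (\<integral>\<^sup>+\<omega>. exit_time X B \<omega> \<partial>P y)"
    by (simp add: expected_exit_time_def nn_integral_completion)
  also have "\<dots> \<le> (\<integral>\<^sup>+\<omega>. (\<Sum>n. ennreal h * indicator (stay B h n) \<omega>) \<partial>P y)"
    by (intro nn_integral_mono exit_time_le_stay assms) (simp add: space_P)
  also have "\<dots> = (\<Sum>n. ennreal h * emeasure (P y) (stay B h n))"
    by (simp add: nn_integral_suminf nn_integral_cmult)
  also have "\<dots> \<le> (\<Sum>n. ennreal (h * q ^ n))"
  proof (intro suminf_le summableI)
    fix n
    have "ennreal h * emeasure (P y) (stay B h n) \<le> ennreal h * ennreal q ^ n"
      unfolding emeasure_stay[OF h assms(2)] by (intro mult_left_mono killed_power_le assms h) auto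
    then show "ennreal h * emeasure (P y) (stay B h n) \<le> ennreal (h * q ^ n)"
      using assms h by (simp add: ennreal_mult ennreal_power)
  qed
  also have "\<dots> = ennreal (\<Sum>n. h * q ^ n)"
    using assms h by (intro suminf_ennreal2 summable_mult summable_geometric) auto
  also have "(\<Sum>n. h * q ^ n) = h / (1 - q)"
    using assms by (subst suminf_mult) (auto simp: suminf_geometric summable_geometric)
  finally show ?thesis .
qed

text \<open>By right continuity the path stays in the open set \<open>A\<close> for a while after
  \<open>s\<close>, and a sufficiently fine dyadic grid has a point in that time span.\<close>

lemma dyadic_before_exit:
  assumes "\<omega> \<in> space M" "0 < T" "open A" "0 \<le> s" "s < T" "X s \<omega> \<in> A"
  shows "\<exists>m. \<exists>k\<in>{1..2 ^ m}. X (real k * (T / 2 ^ m)) \<omega> \<in> A"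
proof -
  have "((\<lambda>u. X u \<omega>) \<longlongrightarrow> X s \<omega>) (at_right s)"
    using right_continuous[OF assms(1,4)] by (simp add: continuous_within)
  then have "\<forall>\<^sub>F u in at_right s. X u \<omega> \<in> A"
    by (rule topological_tendstoD) (use assms in auto)
  then obtain b where b: "s < b" "\<And>u. s < u \<Longrightarrow> u < b \<Longrightarrow> X u \<omega> \<in> A"
    by (auto simp: eventually_at_right_field)
  \<comment> \<open>Length of a span after \<open>s\<close> in which the path is in \<open>A\<close>
    and time \<open>T\<close> has not passed.\<close>
  define d where "d = min b T - s"
  have d: "0 < d" using b assms by (simp add: d_def)
  obtain m where m: "T / d < 2 ^ m" using real_arch_pow[of 2 "T / d"] by auto
  define g where "g = T / 2 ^ m"
  have g: "0 < g" "g < d" using m d assms by (auto simp: g_def field_simps)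
  \<comment> \<open>The first grid index strictly after \<open>s\<close>: it is at least 1, as the
    grid omits time 0, and overshoots \<open>s\<close> by at most one mesh width
    \<open>g < d\<close>.\<close>
  define k where "k = nat \<lfloor>s / g\<rfloor> + 1"
  have "real k = of_int \<lfloor>s / g\<rfloor> + 1" using assms g by (simp add: k_def)
  then have "s / g < real k" "real k \<le> s / g + 1" by linarith+
  then have "s < real k * g" "real k * g \<le> s + g" using g by (simp_all add: field_simps)
  then have u: "s < real k * g" "real k * g < b" "real k * g < T" using g by (auto simp: d_def)
  have "real k < 2 ^ m" using u(3) assms(2) by (simp add: g_def field_simps)
  then have "real k < real (2 ^ m)" by simp
  then have "k \<le> 2 ^ m" by (simp only: of_nat_less_iff)
  moreover have "1 \<le> k" by (simp add: k_def)
  ultimately show ?thesis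
    using b(2)[OF u(1,2)] by (intro exI[of _ m] bexI[of _ k]) (auto simp: g_def)
qed

text \<open>The complement of \<open>ball x r\<close> is closed, while
  \<open>dyadic_before_exit\<close> needs an open set; hence the smaller radius \<open>r'\<close>.
  An exit before time \<open>T\<close> is then seen on some dyadic grid, so with probability at
  least 1/2 the exit time is at least \<open>T\<close>.\<close>

lemma expected_exit_time_ge:
  assumes "0 < T" "r' < r"
    and hit: "\<And>m. hit (- cball x r') (T / 2 ^ m) (2 ^ m) x \<le> ennreal (1 / 2)"
  shows "ennreal (T / 2) \<le> expected_exit_time X P x (ball x r)"
proof -
  interpret prob_space "P x" by (rule prob_space_P)
  let ?A = "- cball x r'"
  define G where "G m = {\<omega> \<in> space M. \<exists>k\<in>{1..2 ^ m}. X (real k * (T / 2 ^ m)) \<omega> \<in> ?A}" for m :: nat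
  define U where "U = (\<Union>m. G m)"
  have A: "?A \<in> sets borel" by measurable
  have G: "G m \<in> sets (P x)" for m
  proof -
    have "G m = space M - stay (cball x r') (T / 2 ^ m) (2 ^ m)"
      by (auto simp: G_def stay_def)
    then show ?thesis
      using stay_sets_P[of "T / 2 ^ m" "cball x r'"] assms(1) sets.compl_sets[of _ "P x"] by (simp add: space_P)
  qed
  then have U: "U \<in> sets (P x)" by (auto simp: U_def)
  \<comment> \<open>The dyadic grids are nested: index \<open>k\<close> becomes
    \<open>2 * k\<close>.\<close>
  have "G m \<subseteq> G (Suc m)" for m
  proof
    fix \<omega> assume "\<omega> \<in> G m"
    then obtain k where k: "\<omega> \<in> space M" "k \<in> {1..2 ^ m}" "X (real k * (T / 2 ^ m)) \<omega> \<in> ?A"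
      by (auto simp: G_def)
    have "real (2 * k) * (T / 2 ^ Suc m) = real k * (T / 2 ^ m)" by simp
    with k show "\<omega> \<in> G (Suc m)"
      unfolding G_def by (intro CollectI conjI bexI[of _ "2 * k"]) auto
  qed
  then have "incseq G" by (rule incseq_SucI)
  then have "emeasure (P x) U = (SUP m. emeasure (P x) (G m))"
    unfolding U_def using G by (subst SUP_emeasure_incseq) auto
  also have "\<dots> \<le> ennreal (1 / 2)"
    using hit assms(1) emeasure_hit[OF _ A, of "T / 2 ^ m" x "2 ^ m" for m] by (intro SUP_least) (simp add: G_def)
  finally have "prob U \<le> 1 / 2" by (simp only: emeasure_eq_measure) (subst (asm) ennreal_le_iff, auto)
  then have *: "1 / 2 \<le> prob (space (P x) - U)" using U by (simp add: prob_compl)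
  have le: "ennreal T * indicator (space (P x) - U) \<omega> \<le> exit_time X (ball x r) \<omega>" if w: "\<omega> \<in> space (P x)" for \<omega>
  proof (cases "\<omega> \<in> U")
    case False
    have "T \<le> s" if s: "0 \<le> s" "X s \<omega> \<notin> ball x r" for s
    proof (rule ccontr)
      assume "\<not> T \<le> s"
      moreover have "X s \<omega> \<in> ?A" using s(2) assms(2) by auto
      ultimately obtain m k where "k \<in> {1..2 ^ m}" "X (real k * (T / 2 ^ m)) \<omega> \<in> ?A"
        using dyadic_before_exit[of \<omega> T ?A s] w s(1) assms(1)
        unfolding space_P by (meson closed_cball not_le open_Compl)
      then have "\<omega> \<in> G m" using w unfolding G_def space_P by blast
      then have "\<omega> \<in> U" by (auto simp: U_def)
      with False show False by simp
    qed
    then have "ennreal T \<le> exit_time X (ball x r) \<omega>"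
      unfolding exit_time_def by (intro Inf_greatest) (auto intro: ennreal_leI)
    then show ?thesis by (auto simp: indicator_def)
  qed simp
  have "ennreal (T / 2) \<le> ennreal (T * prob (space (P x) - U))"
    using * assms(1) by (intro ennreal_leI) (simp add: field_simps)
  also have "\<dots> = (\<integral>\<^sup>+\<omega>. ennreal T * indicator (space (P x) - U) \<omega> \<partial>P x)"
    using U assms(1) by (subst nn_integral_cmult) (auto simp: emeasure_eq_measure ennreal_mult)
  also have "\<dots> \<le> (\<integral>\<^sup>+\<omega>. exit_time X (ball x r) \<omega> \<partial>P x)"
    by (intro nn_integral_mono le)
  finally show ?thesis by (simp add: expected_exit_time_def nn_integral_completion)
qed

end

section \<open>Heat kernel tails\<close>

text \<open>By the mean value theorem. It lets the shell estimates in \<open>tail_upper\<close>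
  telescope.\<close>

lemma powr_diff_ge:
  fixes u b :: real
  assumes "0 < u" "0 < b"
  shows "b * (u + 1) powr (- 1 - b) \<le> u powr (- b) - (u + 1) powr (- b)"
proof -
  have "\<exists>z. u < z \<and> z < u + 1 \<and>
      (u + 1) powr (- b) - u powr (- b) = (u + 1 - u) * (- b * z powr (- b - 1))"
    by (rule MVT2) (use assms in \<open>auto intro!: DERIV_fun_powr derivative_eq_intros\<close>)
  then obtain z where z: "u < z" "z < u + 1"
    and eq: "(u + 1) powr (- b) - u powr (- b) = (u + 1 - u) * (- b * z powr (- b - 1))" by blast
  have "- b - 1 = - 1 - b" by simp
  with eq have eq': "u powr (- b) - (u + 1) powr (- b) = b * z powr (- 1 - b)" by (simp add: algebra_simps)
  have "(u + 1) powr (- 1 - b) \<le> z powr (- 1 - b)"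
    using z assms by (intro powr_mono2') auto
  then show ?thesis unfolding eq' using assms by (intro mult_left_mono) auto
qed

lemma sum_indicator_shells:
  assumes "incseq B"
  shows "(\<Sum>k<N. indicator (B (Suc k) - B k) y) = (indicator (B N - B 0) y :: ennreal)"
proof (induction N)
  case (Suc N)
  have "B 0 \<subseteq> B N" "B N \<subseteq> B (Suc N)" using assms by (auto simp: incseq_def)
  then show ?case using Suc by (auto simp: indicator_def)
qed simp

locale stable_like =
  markov_heat_kernel \<mu> p M F X P V
  for \<mu> :: "'e::metric_space measure" and p :: "real \<Rightarrow> 'e \<Rightarrow> 'e \<Rightarrow> real"
    and M :: "'w measure" and F and X :: "real \<Rightarrow> 'w \<Rightarrow> 'e" and P and V :: "real \<Rightarrow> real" +
  fixes \<alpha> :: real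
  assumes alpha_pos: "0 < \<alpha>"
    and volume_cond: "volume_condition V"
    and kernel_est: "kernel_estimate \<alpha> V p"
begin

section \<open>Volumes of shells and bounds for the tails\<close>

lemma V_mono: "0 < r \<Longrightarrow> r \<le> s \<Longrightarrow> V r \<le> V s"
  using emeasure_mono[of "ball undefined r" "ball undefined s" \<mu>] volume_pos[of s]
  by (auto simp: emeasure_ball sets_mu subset_ball ennreal_le_iff)

lemma emeasure_shell:
  assumes "0 < a" "a \<le> b"
  shows "emeasure \<mu> (ball x b - ball x a) = ennreal (V b - V a)"
  using assms volume_pos[of a] V_mono[of a b]
  by (subst emeasure_Diff) (auto simp: emeasure_ball sets_mu subset_ball ennreal_minus)

text \<open>(K) with \<open>M = 1\<close>, multiplied out; the comparison function is positive since
  \<open>V\<close> is.\<close>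

lemma kernel_bounds:
  "\<exists>K>0. \<forall>t (x :: 'e) y. 0 < t \<longrightarrow> t powr (2 / \<alpha>) < dist x y \<longrightarrow> 1 < dist x y \<longrightarrow>
     p t x y \<le> K * (t * dist x y powr (- 1 - \<alpha> / 2) / V (dist x y)) \<and>
     t * dist x y powr (- 1 - \<alpha> / 2) / V (dist x y) \<le> K * p t x y"
proof -
  let ?g = "\<lambda>t (x :: 'e) y. t * dist x y powr (- 1 - \<alpha> / 2) / V (dist x y)"
  obtain K where K: "K > 0" "\<And>t x y. 0 < t \<Longrightarrow> t powr (2 / \<alpha>) < dist x y \<Longrightarrow> 1 < dist x y \<Longrightarrow>
      1 / K < p t x y / ?g t x y \<and> p t x y / ?g t x y < K"
    using kernel_est unfolding kernel_estimate_def comparable_on_def by (force dest: spec[of _ 1])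
  show ?thesis
  proof (intro exI[of _ K] conjI allI impI)
    fix t and x y :: 'e assume t: "0 < t" "t powr (2 / \<alpha>) < dist x y" "1 < dist x y"
    define g where "g = ?g t x y"
    have g: "0 < g" unfolding g_def using t by (intro divide_pos_pos mult_pos_pos volume_pos) auto
    have "1 / K < p t x y / g" "p t x y / g < K" using K(2)[OF t] unfolding g_def by blast+
    then have "p t x y \<le> K * g" "g \<le> K * p t x y"
      using g K(1) by (simp_all add: field_simps)
    then show "p t x y \<le> K * ?g t x y" "?g t x y \<le> K * p t x y" unfolding g_def by blast+
  qed (rule K(1))
qed

text \<open>On a shell of width 1 the factor \<open>1 / V\<close> of (K) cancels the volume up to
  the ratio \<open>V (r + 1) / V r\<close>, which (V) bounds. What remains is a sum of powers of the
  radii, dominated by a telescoping sum.\<close>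

lemma tail_upper:
  "\<exists>C>0. \<forall>\<rho>\<ge>2. \<forall>t>0. \<forall>x. t powr (2 / \<alpha>) < \<rho> \<longrightarrow>
     transition t (indicator (- ball x \<rho>)) x \<le> ennreal (C * t * \<rho> powr (- \<alpha> / 2))"
proof -
  obtain K where K: "K > 0" "\<And>t x y. 0 < t \<Longrightarrow> t powr (2 / \<alpha>) < dist x y \<Longrightarrow> 1 < dist x y \<Longrightarrow>
     p t x y \<le> K * (t * dist x y powr (- 1 - \<alpha> / 2) / V (dist x y))"
    using kernel_bounds by metis
  obtain D where D: "D > 0" "\<And>r. 1 \<le> r \<Longrightarrow> V (r + 1) / V r < D"
    using volume_cond unfolding volume_condition_def comparable_on_def by auto
  define b where "b = \<alpha> / 2"
  have b: "0 < b" using alpha_pos by (simp add: b_def)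
  \<comment> \<open>\<open>K\<close> comes from the kernel, \<open>D\<close> from the volume ratio,
    \<open>b\<close> from \<open>powr_diff_ge\<close>.\<close>
  define C where "C = K * D / b"
  have C: "0 < C" using K D b by (simp add: C_def)
  show ?thesis
  proof (intro exI[of _ "C * 2 powr b"] conjI allI impI)
    fix \<rho> t :: real and x :: 'e assume \<rho>: "2 \<le> \<rho>" and t: "0 < t" "t powr (2 / \<alpha>) < \<rho>"
    define s where "s k = \<rho> + real k" for k
    \<comment> \<open>Shifted by one because \<open>powr_diff_ge\<close> has its power at the right
      end point, which is to be the inner radius \<open>s k\<close>; \<open>\<rho> \<ge> 2\<close>
      keeps the base positive.\<close>
    define f where "f k = (\<rho> - 1 + real k) powr (- b)" for k :: nat
    let ?S = "\<lambda>k. ball x (s (Suc k)) - ball x (s k)"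
    have Sb: "(indicator (?S k) :: 'e \<Rightarrow> ennreal) \<in> borel_measurable borel" for k
      by (intro borel_measurable_indicator sets.Diff borel_open open_ball)
    have s: "2 \<le> s k" "s (Suc k) = s k + 1" for k using \<rho> by (auto simp: s_def)
    have shell: "transition t (indicator (?S k)) x \<le> ennreal (C * t * (f k - f (Suc k)))" for k
    proof -
      have Vk: "0 < V (s k)" using s[of k] by (intro volume_pos) simp
      have le: "p t x y \<le> K * (t * s k powr (- 1 - b) / V (s k))" if "y \<in> ?S k" for y
      proof -
        have d: "s k \<le> dist x y" using that by simp
        then have "t powr (2 / \<alpha>) < dist x y" "1 < dist x y" using t \<rho> s[of k] by (auto simp: s_def)
        from K(2)[OF t(1) this] have "p t x y \<le> K * (t * dist x y powr (- 1 - b) / V (dist x y))"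
          by (simp add: b_def)
        also have "\<dots> \<le> K * (t * s k powr (- 1 - b) / V (s k))"
          using d s[of k] t K b Vk V_mono[OF _ d]
          by (intro mult_left_mono frac_le powr_mono2') auto
        finally show ?thesis .
      qed
      have "transition t (indicator (?S k)) x = (\<integral>\<^sup>+y. ennreal (p t x y) * indicator (?S k) y \<partial>\<mu>)"
        by (rule transition_eq[OF t(1) Sb])
      also have "\<dots> \<le> (\<integral>\<^sup>+y. ennreal (K * (t * s k powr (- 1 - b) / V (s k))) * indicator (?S k) y \<partial>\<mu>)"
        using le by (intro nn_integral_mono) (auto simp: indicator_def intro!: ennreal_leI)
      also have "\<dots> = ennreal (K * (t * s k powr (- 1 - b) / V (s k))) * emeasure \<mu> (?S k)"
        by (rule nn_integral_cmult_indicator) (simp add: sets_mu)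
      also have "\<dots> \<le> ennreal (K * (t * s k powr (- 1 - b) / V (s k))) * ennreal (V (s k + 1))"
        using s[of k] Vk by (subst emeasure_shell) (auto intro!: mult_left_mono ennreal_leI)
      also have "\<dots> = ennreal (K * (t * s k powr (- 1 - b)) * (V (s k + 1) / V (s k)))"
        using K t Vk volume_pos[of "s k + 1"] s[of k] by (subst ennreal_mult[symmetric]) auto
      also have "\<dots> \<le> ennreal (K * (t * s k powr (- 1 - b)) * D)"
        using K t s[of k] D(2)[of "s k"] by (intro ennreal_leI mult_left_mono) auto
      also have "\<dots> \<le> ennreal (C * t * (f k - f (Suc k)))"
      proof (rule ennreal_leI)
        have "b * (s k powr (- 1 - b)) \<le> f k - f (Suc k)"
          using powr_diff_ge[of "\<rho> - 1 + real k" b] \<rho> b by (simp add: f_def s_def algebra_simps)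
        then have "C * t * (b * (s k powr (- 1 - b))) \<le> C * t * (f k - f (Suc k))"
          using C t by (intro mult_left_mono) auto
        then show "K * (t * s k powr (- 1 - b)) * D \<le> C * t * (f k - f (Suc k))"
          using b by (simp add: C_def ac_simps)
      qed
      finally show ?thesis .
    qed
    have decr: "f (Suc k) \<le> f k" for k
      using \<rho> b by (auto simp: f_def intro!: powr_mono2')
    have cover: "- ball x \<rho> \<subseteq> (\<Union>k. ?S k)"
    proof
      fix y assume "y \<in> - ball x \<rho>"
      then have y: "\<rho> \<le> dist x y" by simp
      define k where "k = nat \<lfloor>dist x y - \<rho>\<rfloor>"
      have "real k = of_int \<lfloor>dist x y - \<rho>\<rfloor>" using y by (simp add: k_def)
      then have "real k \<le> dist x y - \<rho>" "dist x y - \<rho> < real k + 1" by linarith+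
      then have "y \<in> ?S k" by (auto simp: s_def)
      then show "y \<in> (\<Union>k. ?S k)" by blast
    qed
    have "transition t (indicator (- ball x \<rho>)) x \<le> transition t (\<lambda>y. \<Sum>k. indicator (?S k) y) x"
    proof (rule transition_mono)
      fix y
      show "indicator (- ball x \<rho>) y \<le> (\<Sum>k. indicator (?S k) y :: ennreal)"
      proof (cases "y \<in> - ball x \<rho>")
        case True
        then obtain k where "y \<in> ?S k" using cover by blast
        then have "indicator (- ball x \<rho>) y \<le> (\<Sum>k\<in>{k}. indicator (?S k) y :: ennreal)"
          by (simp add: indicator_def)
        also have "\<dots> \<le> (\<Sum>k. indicator (?S k) y)" by (rule sum_le_suminf) auto
        finally show ?thesis .
      qed simp
    qed
    also have "\<dots> = (\<Sum>k. transition t (indicator (?S k)) x)"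
      unfolding transition_def using t(1) by (intro nn_integral_suminf measurable_comp_X Sb) simp
    also have "\<dots> \<le> ennreal (C * t * f 0)"
    proof (rule suminf_le_const)
      fix n
      have "(\<Sum>k<n. transition t (indicator (?S k)) x) \<le> (\<Sum>k<n. ennreal (C * t * (f k - f (Suc k))))"
        by (intro sum_mono shell)
      also have "\<dots> = ennreal (\<Sum>k<n. C * t * (f k - f (Suc k)))"
        using C t decr by (intro sum_ennreal) auto
      also have "(\<Sum>k<n. C * t * (f k - f (Suc k))) = C * t * (f 0 - f n)"
        by (simp add: sum_distrib_left[symmetric] sum_lessThan_telescope')
      also have "ennreal \<dots> \<le> ennreal (C * t * f 0)"
        using C t by (intro ennreal_leI mult_left_mono) (auto simp: f_def)
      finally show "(\<Sum>k<n. transition t (indicator (?S k)) x) \<le> ennreal (C * t * f 0)" .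
    qed auto
    also have "\<dots> \<le> ennreal (C * 2 powr b * t * \<rho> powr (- \<alpha> / 2))"
    proof (rule ennreal_leI)
      \<comment> \<open>For \<open>\<rho> \<ge> 2\<close>, \<open>\<rho> - 1\<close> is at least
        \<open>\<rho> / 2\<close>; undoing the shift costs the factor
        \<open>2 powr b\<close>.\<close>
      have "f 0 \<le> (\<rho> / 2) powr (- b)" using \<rho> b by (auto simp: f_def intro!: powr_mono2')
      also have "\<dots> = 2 powr b * \<rho> powr (- \<alpha> / 2)"
        using \<rho> by (simp add: powr_divide powr_minus b_def field_simps)
      finally have "C * t * f 0 \<le> C * t * (2 powr b * \<rho> powr (- \<alpha> / 2))"
        using C t by (intro mult_left_mono) auto
      then show "C * t * f 0 \<le> C * 2 powr b * t * \<rho> powr (- \<alpha> / 2)" by (simp add: ac_simps)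
    qed
    finally show "transition t (indicator (- ball x \<rho>)) x \<le> ennreal (C * 2 powr b * t * \<rho> powr (- \<alpha> / 2))" .
  qed (use C in simp)
qed

text \<open>At this time (K) applies beyond distance \<open>r\<close>. Take about \<open>r\<close>
  shells of width \<open>A\<close> beyond radius \<open>2 * r\<close>: by (V) each contains a fixed
  proportion of its outer ball, which compensates \<open>1 / V\<close>, so each carries probability
  of order at least \<open>1 / r\<close>.\<close>

lemma tail_lower:
  "\<exists>c>0. \<forall>r>1. \<forall>x. ennreal c \<le> transition (r powr (\<alpha> / 2)) (indicator (- ball x (2 * r))) x"
proof -
  obtain K where K: "K > 0" "\<And>t x y. 0 < t \<Longrightarrow> t powr (2 / \<alpha>) < dist x y \<Longrightarrow> 1 < dist x y \<Longrightarrow>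
     t * dist x y powr (- 1 - \<alpha> / 2) / V (dist x y) \<le> K * p t x y"
    using kernel_bounds by metis
  obtain A c1 where A: "1 \<le> A" "c1 < 1" "\<And>r. 1 \<le> r \<Longrightarrow> V r \<le> c1 * V (r + A)"
    using volume_cond unfolding volume_condition_def by blast
  define b where "b = \<alpha> / 2"
  have b: "0 < b" using alpha_pos by (simp add: b_def)
  \<comment> \<open>\<open>1 - c1\<close> is the proportion of the volume that (V) leaves to a
    shell, and \<open>4 * A * r\<close> bounds the outer radii.\<close>
  define c where "c = (1 - c1) / K * (4 * A) powr (- 1 - b)"
  have c: "0 < c" using A K by (simp add: c_def)
  show ?thesis
  proof (intro exI[of _ c] conjI allI impI)
    fix r :: real and x :: 'e assume r: "1 < r"
    define t where "t = r powr b"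
    have t: "0 < t" "t powr (2 / \<alpha>) = r"
      using r alpha_pos by (auto simp: t_def b_def powr_powr)
    \<comment> \<open>At least \<open>r\<close> shells, to collect the mass \<open>c\<close>, and at
      most \<open>r + 1\<close>, to keep their radii of order \<open>r\<close>.\<close>
    define N where "N = nat \<lceil>r\<rceil>"
    have N: "r \<le> real N" "real N \<le> r + 1" using r unfolding N_def by linarith+
    define s where "s k = 2 * r + real k * A" for k
    let ?S = "\<lambda>k. ball x (s (Suc k)) - ball x (s k)"
    have Sb: "(indicator (?S k) :: 'e \<Rightarrow> ennreal) \<in> borel_measurable borel" for k
      by (intro borel_measurable_indicator sets.Diff borel_open open_ball)
    have s: "2 * r \<le> s k" "s (Suc k) = s k + A" for k using A by (auto simp: s_def algebra_simps)
    have shell: "ennreal (c / r) \<le> transition t (indicator (?S k)) x" if k: "k < N" for k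
    proof -
      define W where "W = V (s (Suc k))"
      have W: "0 < W" unfolding W_def using s[of "Suc k"] r by (intro volume_pos) simp
      have "real (Suc k) * A \<le> (r + 1) * A" using k N A by (intro mult_right_mono) auto
      also have "\<dots> \<le> 2 * r * A" using r A by (intro mult_right_mono) auto
      finally have "s (Suc k) \<le> 1 * (2 * r) + 2 * r * A" by (simp add: s_def)
      also have "\<dots> \<le> A * (2 * r) + 2 * r * A" using A r by (intro add_right_mono mult_right_mono) auto
      finally have sk: "s (Suc k) \<le> 4 * A * r" by simp
      have le: "t * (4 * A * r) powr (- 1 - b) / W / K \<le> p t x y" if "y \<in> ?S k" for y
      proof -
        have d: "s k \<le> dist x y" "dist x y \<le> s (Suc k)" using that by auto
        then have d': "t powr (2 / \<alpha>) < dist x y" "1 < dist x y" using t r s[of k] by auto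
        then have d0: "0 < dist x y" by linarith
        have "t * (4 * A * r) powr (- 1 - b) / W \<le> t * dist x y powr (- 1 - b) / V (dist x y)"
          unfolding W_def using d d' d0 sk t b volume_pos[OF d0] V_mono[OF d0 d(2)]
          by (intro frac_le mult_left_mono powr_mono2') auto
        also have "\<dots> \<le> K * p t x y" using K(2)[OF t(1) d'] by (simp add: b_def)
        finally show ?thesis
          by (subst pos_divide_le_eq[OF K(1)]) (simp only: mult.commute)
      qed
      have "V (s k) \<le> c1 * W" using A(3)[of "s k"] s[of k] r by (simp add: W_def)
      then have diff: "(1 - c1) * W \<le> W - V (s k)" by (simp add: algebra_simps)
      have "c / r = t * (4 * A * r) powr (- 1 - b) / W / K * ((1 - c1) * W)"
      proof -
        have "t * (4 * A * r) powr (- 1 - b) = (4 * A) powr (- 1 - b) * (r powr b * r powr (- 1 - b))"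
          using A r by (simp add: t_def powr_mult)
        also have "r powr b * r powr (- 1 - b) = 1 / r"
          using r by (simp add: powr_add[symmetric] powr_minus_divide)
        finally show ?thesis using W K r by (simp add: c_def field_simps)
      qed
      then have "ennreal (c / r) \<le> ennreal (t * (4 * A * r) powr (- 1 - b) / W / K * (W - V (s k)))"
        using diff t W K A by (simp only:) (intro ennreal_leI mult_left_mono divide_nonneg_pos mult_nonneg_nonneg, auto)
      also have "\<dots> = ennreal (t * (4 * A * r) powr (- 1 - b) / W / K) * emeasure \<mu> (?S k)"
      proof -
        have "V (s k) \<le> W" using s[of k] r A unfolding W_def by (intro V_mono) auto
        moreover have "0 \<le> t * (4 * A * r) powr (- 1 - b) / W / K" using t W K by simp
        moreover have "emeasure \<mu> (?S k) = ennreal (W - V (s k))"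
          using s[of k] r A unfolding W_def by (intro emeasure_shell) auto
        ultimately show ?thesis by (simp only: ennreal_mult diff_ge_0_iff_ge)
      qed
      also have "\<dots> = (\<integral>\<^sup>+y. ennreal (t * (4 * A * r) powr (- 1 - b) / W / K) * indicator (?S k) y \<partial>\<mu>)"
        by (rule nn_integral_cmult_indicator[symmetric]) (simp add: sets_mu)
      also have "\<dots> \<le> (\<integral>\<^sup>+y. ennreal (p t x y) * indicator (?S k) y \<partial>\<mu>)"
        using le by (intro nn_integral_mono) (auto simp: indicator_def intro!: ennreal_leI)
      also have "\<dots> = transition t (indicator (?S k)) x"
        by (rule transition_eq[OF t(1) Sb, symmetric])
      finally show ?thesis .
    qed
    have "c = r * (c / r)" using r by simp
    also have "\<dots> \<le> real N * (c / r)" using N c r by (intro mult_right_mono) auto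
    finally have "ennreal c \<le> ennreal (real N * (c / r))" by (rule ennreal_leI)
    also have "\<dots> = (\<Sum>k<N. ennreal (c / r))"
      using c r by (simp add: ennreal_mult ennreal_of_nat_eq_real_of_nat del: times_divide_eq_right)
    also have "\<dots> \<le> (\<Sum>k<N. transition t (indicator (?S k)) x)"
      by (intro sum_mono shell) auto
    also have "\<dots> = transition t (\<lambda>y. \<Sum>k<N. indicator (?S k) y) x"
      using t(1) by (intro transition_sum[symmetric] Sb) simp
    also have "\<dots> \<le> transition t (indicator (- ball x (2 * r))) x"
    proof (rule transition_mono)
      fix y
      have "incseq (\<lambda>k. ball x (s k))" using A by (intro incseq_SucI subset_ball) (simp add: s)
      from sum_indicator_shells[OF this, of y N]
      show "(\<Sum>k<N. indicator (?S k) y) \<le> (indicator (- ball x (2 * r)) y :: ennreal)"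
        by (auto simp: indicator_def s_def)
    qed
    finally show "ennreal c \<le> transition (r powr (\<alpha> / 2)) (indicator (- ball x (2 * r))) x"
      by (simp add: t_def b_def)
  qed (rule c)
qed

end

section \<open>Expected exit times from balls\<close>

context strong_markov_process
begin

lemma transition_compl:
  assumes "0 \<le> t" "B \<in> sets borel"
  shows "transition t (indicator B) x + transition t (indicator (- B)) x = 1"
proof -
  have "- B \<in> sets borel" using assms by simp
  then have "transition t (indicator B) x + transition t (indicator (- B)) x
      = transition t (\<lambda>y. indicator B y + indicator (- B) y) x"
    using assms by (intro transition_add[symmetric]) auto
  also have "(\<lambda>y. indicator B y + indicator (- B) y) = (\<lambda>_. 1 :: ennreal)"
    by (auto simp: fun_eq_iff indicator_def)
  finally show ?thesis by (simp add: transition_const)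
qed

lemma hit_Un_le:
  assumes "0 \<le> h" "A \<in> sets borel" "B \<in> sets borel"
  shows "hit (A \<union> B) h n x \<le> hit A h n x + hit B h n x"
proof -
  let ?E = "\<lambda>C. {\<omega> \<in> space M. \<exists>k\<in>{1..n}. X (real k * h) \<omega> \<in> C}"
  have E: "?E C \<in> sets (P x)" if "C \<in> sets borel" for C
  proof -
    have "?E C = space (P x) - stay (- C) h n" by (auto simp: stay_def space_P)
    then show ?thesis using stay_sets_P[of h "- C" n x] assms(1) that by simp
  qed
  have "?E (A \<union> B) = ?E A \<union> ?E B" by auto
  then have "emeasure (P x) (?E (A \<union> B)) \<le> emeasure (P x) (?E A) + emeasure (P x) (?E B)"
    using emeasure_subadditive[OF E[OF assms(2)] E[OF assms(3)]] by simp
  then show ?thesis using assms by (simp only: emeasure_hit sets.Un)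
qed

end

lemma ennreal_add_le_one:
  assumes "a + b = (1 :: ennreal)" "ennreal c \<le> b" "0 \<le> c"
  shows "a \<le> ennreal (1 - c)"
proof -
  have "a + ennreal c \<le> 1" using assms by (metis add_left_mono)
  then show ?thesis using assms(3)
    by (cases a) (auto simp: ennreal_plus[symmetric] ennreal_le_1 top_unique simp del: ennreal_plus intro!: ennreal_leI)
qed

lemma ennreal_add_ge_one:
  assumes "a + b = (1 :: ennreal)" "b \<le> ennreal c" "0 \<le> c"
  shows "ennreal (1 - c) \<le> a"
proof -
  have "1 \<le> a + ennreal c" using assms by (metis add_left_mono)
  then show ?thesis using assms(3)
    by (cases a) (auto simp: ennreal_plus[symmetric] ennreal_1[symmetric] ennreal_le_iff simp del: ennreal_plus ennreal_1 intro!: ennreal_leI)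
qed

context stable_like
begin

text \<open>For \<open>z\<close> in \<open>ball x r\<close> the larger ball
  \<open>ball z (2 * r)\<close> contains \<open>ball x r\<close>. So from every such
  \<open>z\<close> one time step ends outside \<open>ball x r\<close> with probability at least the
  constant of \<open>tail_lower\<close>.\<close>

lemma expected_exit_time_upper:
  "\<exists>c>0. \<forall>r>1. \<forall>x. \<forall>y\<in>ball x r.
     expected_exit_time X P y (ball x r) \<le> ennreal (c * r powr (\<alpha> / 2))"
proof -
  obtain c where c: "0 < c"
    "\<And>r x. 1 < r \<Longrightarrow> ennreal c \<le> transition (r powr (\<alpha> / 2)) (indicator (- ball x (2 * r))) x"
    using tail_lower by blast
  \<comment> \<open>The survival factor \<open>1 - c\<close> has to be nonnegative.\<close>
  have "c \<le> 1"
  proof -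
    have "ennreal c \<le> transition (2 powr (\<alpha> / 2)) (indicator (- ball undefined (2 * 2))) undefined"
      by (rule c) simp
    also have "\<dots> \<le> transition (2 powr (\<alpha> / 2)) (\<lambda>_. 1) undefined"
      by (intro transition_mono) (auto simp: indicator_def)
    finally show ?thesis by (simp add: transition_const ennreal_le_1)
  qed
  show ?thesis
  proof (intro exI[of _ "1 / c"] conjI allI impI ballI)
    fix r :: real and x y :: 'e assume r: "1 < r" and y: "y \<in> ball x r"
    let ?t = "r powr (\<alpha> / 2)"
    have "expected_exit_time X P y (ball x r) \<le> ennreal (?t / (1 - (1 - c)))"
    proof (rule expected_exit_time_le[OF _ _ _ _ y])
      fix z assume z: "z \<in> ball x r"
      have sub: "- ball z (2 * r) \<subseteq> - ball x r"
      proof (rule subsetI)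
        fix w assume "w \<in> - ball z (2 * r)"
        then show "w \<in> - ball x r" using z dist_triangle[of z w x] by (simp add: dist_commute)
      qed
      have "ennreal c \<le> transition ?t (indicator (- ball z (2 * r))) z" by (rule c(2)[OF r])
      also have "\<dots> \<le> transition ?t (indicator (- ball x r)) z"
        using sub by (intro transition_mono) (auto simp: indicator_def)
      finally show "transition ?t (indicator (ball x r)) z \<le> ennreal (1 - c)"
        using c(1) by (intro ennreal_add_le_one[OF transition_compl]) auto
    qed (use r c \<open>c \<le> 1\<close> in auto)
    then show "expected_exit_time X P y (ball x r) \<le> ennreal (1 / c * ?t)" by simp
  qed (use c in simp)
qed

text \<open>Supplies the assumption \<open>ret\<close> of \<open>first_passage\<close> and
  \<open>hit_le_of_kernel_le\<close>: at each time up to \<open>T\<close> the process is within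
  \<open>\<rho>\<close> of its start with probability at least 1/2. Time 0, outside the scope of the
  tail bound, follows from normality.\<close>

lemma return_of_tail:
  assumes C: "\<And>\<rho> t x. 2 \<le> \<rho> \<Longrightarrow> 0 < t \<Longrightarrow> t powr (2 / \<alpha>) < \<rho> \<Longrightarrow>
      transition t (indicator (- ball x \<rho>)) x \<le> ennreal (C * t * \<rho> powr (- \<alpha> / 2))"
    and "0 < C" "2 \<le> \<rho>" "T powr (2 / \<alpha>) < \<rho>" "C * T * \<rho> powr (- \<alpha> / 2) \<le> 1 / 2"
    and "0 \<le> s" "s \<le> T" "ball a \<rho> \<subseteq> D"
  shows "ennreal (1 / 2) \<le> transition s (indicator D) a"
proof -
  have "ennreal (1 / 2) \<le> transition s (indicator (ball a \<rho>)) a"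
  proof (cases "s = 0")
    case True
    then have "transition s (indicator (ball a \<rho>)) a = 1"
      using assms(3) transition_0[of "indicator (ball a \<rho>)" a]
      by (simp add: borel_measurable_indicator)
    moreover have "ennreal (1 / 2) \<le> 1" by (subst ennreal_le_1) simp
    ultimately show ?thesis by simp
  next
    case False
    have "s powr (2 / \<alpha>) \<le> T powr (2 / \<alpha>)"
      using assms alpha_pos by (intro powr_mono2) auto
    then have "transition s (indicator (- ball a \<rho>)) a \<le> ennreal (C * s * \<rho> powr (- \<alpha> / 2))"
      using assms False by (intro C) auto
    also have "\<dots> \<le> ennreal (1 / 2)"
    proof (rule ennreal_leI)
      have "C * s * \<rho> powr (- \<alpha> / 2) \<le> C * T * \<rho> powr (- \<alpha> / 2)"
        using assms by (intro mult_right_mono mult_left_mono) auto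
      then show "C * s * \<rho> powr (- \<alpha> / 2) \<le> 1 / 2" using assms(5) by linarith
    qed
    finally have "ennreal (1 - 1 / 2) \<le> transition s (indicator (ball a \<rho>)) a"
      using assms by (intro ennreal_add_ge_one[OF transition_compl]) auto
    then show ?thesis by simp
  qed
  also have "\<dots> \<le> transition s (indicator D) a"
    using assms by (intro transition_mono) (auto simp: indicator_def)
  finally show ?thesis .
qed

text \<open>After a visit at distance at least \<open>2 * \<rho>\<close> from \<open>x\<close>, the
  process is outside \<open>ball x \<rho>\<close> at the final time with probability at least 1/2.
  So half of the hitting probability is at most the tail at \<open>\<rho>\<close>, which is at most
  \<open>\<delta>\<close>.\<close>

lemma far_hit_le:
  assumes C: "\<And>\<rho> t x. 2 \<le> \<rho> \<Longrightarrow> 0 < t \<Longrightarrow> t powr (2 / \<alpha>) < \<rho> \<Longrightarrow>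
      transition t (indicator (- ball x \<rho>)) x \<le> ennreal (C * t * \<rho> powr (- \<alpha> / 2))"
    and "0 < C" "2 \<le> \<rho>" "T powr (2 / \<alpha>) < \<rho>" "C * T * \<rho> powr (- \<alpha> / 2) \<le> \<delta>" "\<delta> \<le> 1 / 2"
    and "0 < h" "0 < n" "real n * h = T" "A \<in> sets borel" "A \<subseteq> - ball x (2 * \<rho>)"
  shows "hit A h n x \<le> ennreal (2 * \<delta>)"
proof -
  have T: "0 < T" using assms(7-9) by (metis mult_pos_pos of_nat_0_less_iff)
  have "0 \<le> C * T * \<rho> powr (- \<alpha> / 2)" using assms(2) T by simp
  then have \<delta>: "0 \<le> \<delta>" using assms by linarith
  have "ennreal (1 / 2) * hit A h n x \<le> transition (real n * h) (indicator (- ball x \<rho>)) x"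
  proof (rule first_passage)
    fix a and j :: nat assume a: "a \<in> A" and j: "j < n"
    have "real j * h \<le> real n * h" using j assms by (intro mult_right_mono) auto
    moreover have "ball a \<rho> \<subseteq> - ball x \<rho>"
    proof
      fix y assume "y \<in> ball a \<rho>"
      moreover have "2 * \<rho> \<le> dist x a" using a assms by auto
      ultimately show "y \<in> - ball x \<rho>"
        using dist_triangle[of x a y] by (simp add: dist_commute)
    qed
    ultimately show "ennreal (1 / 2) \<le> transition (real j * h) (indicator (- ball x \<rho>)) a"
      using assms by (intro return_of_tail[OF C assms(2-4)]) auto
  qed (use assms in auto)
  also have "\<dots> \<le> ennreal (C * T * \<rho> powr (- \<alpha> / 2))"
    unfolding assms(9) using assms T by (intro C) auto
  also have "\<dots> \<le> ennreal \<delta>" by (rule ennreal_leI) fact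
  finally have "ennreal 2 * (ennreal (1 / 2) * hit A h n x) \<le> ennreal 2 * ennreal \<delta>"
    by (rule mult_left_mono) simp
  then show ?thesis
    using \<delta> by (simp only: mult.assoc[symmetric] ennreal_mult[symmetric]) simp
qed

lemma expected_exit_time_lower_large:
  "\<exists>c>0. \<forall>r\<ge>8. \<forall>x. ennreal (c * r powr (\<alpha> / 2)) \<le> expected_exit_time X P x (ball x r)"
proof -
  obtain C where C: "0 < C"
    "\<And>\<rho> t x. 2 \<le> \<rho> \<Longrightarrow> 0 < t \<Longrightarrow> t powr (2 / \<alpha>) < \<rho> \<Longrightarrow>
      transition t (indicator (- ball x \<rho>)) x \<le> ennreal (C * t * \<rho> powr (- \<alpha> / 2))"
    using tail_upper by blast
  \<comment> \<open>The first entry makes the tail at most 1/4, hence the hitting probability at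
    most 1/2; the second keeps \<open>T powr (2 / \<alpha>)\<close> below
    \<open>\<rho>\<close>.\<close>
  define e where "e = min (1 / (4 * C)) (1 / 2)"
  have e: "0 < e" "e \<le> 1 / 2" "C * e \<le> 1 / 4"
    using C(1) by (auto simp: e_def min_def field_simps)
  show ?thesis
  proof (intro exI[of _ "e * (1 / 4) powr (\<alpha> / 2) / 2"] conjI allI impI)
    fix r :: real and x :: 'e assume r: "8 \<le> r"
    \<comment> \<open>With a quarter of \<open>r\<close>, \<open>2 * \<rho> < r\<close> holds, and
      \<open>r \<ge> 8\<close> gives \<open>\<rho> \<ge> 2\<close>.\<close>
    define \<rho> where "\<rho> = r / 4"
    define T where "T = e * \<rho> powr (\<alpha> / 2)"
    have \<rho>: "2 \<le> \<rho>" using r by (simp add: \<rho>_def)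
    have T: "0 < T" using e \<rho> by (simp add: T_def)
    have "T < \<rho> powr (\<alpha> / 2)" using e \<rho> by (simp add: T_def)
    then have "T powr (2 / \<alpha>) < (\<rho> powr (\<alpha> / 2)) powr (2 / \<alpha>)"
      using T alpha_pos by (intro powr_less_mono2) auto
    then have T\<rho>: "T powr (2 / \<alpha>) < \<rho>" using \<rho> alpha_pos by (simp add: powr_powr)
    have "\<rho> powr (\<alpha> / 2) * \<rho> powr (- \<alpha> / 2) = 1"
      using \<rho> by (simp add: powr_add[symmetric])
    then have "C * T * \<rho> powr (- \<alpha> / 2) = C * e" by (simp add: T_def)
    with e have CT: "C * T * \<rho> powr (- \<alpha> / 2) \<le> 1 / 4" by linarith
    have "ennreal (T / 2) \<le> expected_exit_time X P x (ball x r)"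
    proof (rule expected_exit_time_ge[OF T])
      show "2 * \<rho> < r" using r by (simp add: \<rho>_def)
      fix m
      have "- cball x (2 * \<rho>) \<in> sets borel" by measurable
      then have "hit (- cball x (2 * \<rho>)) (T / 2 ^ m) (2 ^ m) x \<le> ennreal (2 * (1 / 4))"
        using T by (intro far_hit_le[OF C(2) C(1) \<rho> T\<rho> CT]) auto
      then show "hit (- cball x (2 * \<rho>)) (T / 2 ^ m) (2 ^ m) x \<le> ennreal (1 / 2)" by simp
    qed
    also have "T / 2 = e * (1 / 4) powr (\<alpha> / 2) / 2 * r powr (\<alpha> / 2)"
      using r powr_mult[of "1 / 4" r "\<alpha> / 2"] by (simp add: T_def \<rho>_def)
    finally show "ennreal (e * (1 / 4) powr (\<alpha> / 2) / 2 * r powr (\<alpha> / 2))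
        \<le> expected_exit_time X P x (ball x r)" .
  qed (use e in simp)
qed

text \<open>Points of the annulus have distance more than 1 from \<open>x\<close>, so (K) bounds the
  kernel there by a multiple of \<open>T\<close> at all times up to \<open>T\<close>, and
  \<open>hit_le_of_kernel_le\<close> passes this factor on. The returns are to
  \<open>ball x 6\<close>, which contains the ball of radius 2 about each point of the
  annulus.\<close>

lemma near_hit_le:
  "\<exists>L>0. \<exists>T0>0. \<forall>T h n x. 0 < h \<longrightarrow> 0 < n \<longrightarrow> real n * h = T \<longrightarrow> T \<le> T0 \<longrightarrow>
     hit (ball x 4 - cball x 1) h n x \<le> ennreal (L * T)"
proof -
  obtain C where C: "0 < C"
    "\<And>\<rho> t x. 2 \<le> \<rho> \<Longrightarrow> 0 < t \<Longrightarrow> t powr (2 / \<alpha>) < \<rho> \<Longrightarrow>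
      transition t (indicator (- ball x \<rho>)) x \<le> ennreal (C * t * \<rho> powr (- \<alpha> / 2))"
    using tail_upper by blast
  obtain K where K: "K > 0" "\<And>t x y. 0 < t \<Longrightarrow> t powr (2 / \<alpha>) < dist x y \<Longrightarrow> 1 < dist x y \<Longrightarrow>
     p t x y \<le> K * (t * dist x y powr (- 1 - \<alpha> / 2) / V (dist x y))"
    using kernel_bounds by metis
  have V: "0 < V 1" "0 < V 4" "0 < V 6" by (auto intro: volume_pos)
  \<comment> \<open>The bound of \<open>hit_le_of_kernel_le\<close> with
    \<open>\<theta> = 1 / 2\<close>, doubled to clear this factor.\<close>
  define L where "L = 2 * (K / V 1 * (1 / 2 * V 4 + V 6))"
  \<comment> \<open>The first entry puts all times up to \<open>T\<close> in the range of (K) for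
    every distance above 1; the second makes displacements below 2 have probability at least
    1/2.\<close>
  define T0 where "T0 = min (1 / 2) (1 / (2 * C * 2 powr (- \<alpha> / 2)))"
  have L: "0 < L" using K V by (simp add: L_def)
  have T0: "0 < T0" using C by (simp add: T0_def)
  show ?thesis
  proof (rule exI[of _ L], rule conjI[OF L], rule exI[of _ T0], rule conjI[OF T0], intro allI impI)
    fix T h :: real and n :: nat and x :: 'e
    assume h: "0 < h" and n: "0 < n" and nh: "real n * h = T" and T0: "T \<le> T0"
    let ?A = "ball x 4 - cball x 1"
    have T: "0 < T" "T \<le> 1 / 2" "T \<le> 1 / (2 * C * 2 powr (- \<alpha> / 2))"
      using h n nh T0 by (auto simp: T0_def)
    have CT: "C * T * 2 powr (- \<alpha> / 2) \<le> 1 / 2"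
      using T(3) C by (simp add: field_simps)
    have small: "s powr (2 / \<alpha>) < 1" if "0 < s" "s \<le> T" for s
      using powr_less_mono2[of "2 / \<alpha>" s 1] that T alpha_pos by simp
    have "ennreal (1 / 2) * hit ?A h n x
        \<le> ennreal (K * T / V 1) * (ennreal (1 / 2) * emeasure \<mu> ?A + emeasure \<mu> (ball x 6))"
    proof (rule hit_le_of_kernel_le[OF h])
      show "?A \<in> sets borel" "ball x 6 \<in> sets borel" by (auto intro: sets.Diff)
      fix a assume a: "a \<in> ?A"
      have sub: "ball a 2 \<subseteq> ball x 6"
      proof
        fix y assume "y \<in> ball a 2"
        then show "y \<in> ball x 6" using a dist_triangle[of x y a] by (simp add: dist_commute)
      qed
      show "ennreal (1 / 2) \<le> transition (real j * h) (indicator (ball x 6)) a" if "j < n" for j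
      proof -
        have "real j * h \<le> T" using that h unfolding nh[symmetric] by (intro mult_right_mono) auto
        moreover have "T powr (2 / \<alpha>) < 2" using small[of T] T by simp
        ultimately show ?thesis
          using h sub CT by (intro return_of_tail[OF C(2) C(1), where \<rho> = 2 and T = T]) auto
      qed
      show "ennreal (p (real k * h) x a) \<le> ennreal (K * T / V 1)" if "k \<in> {1..n}" for k
      proof (rule ennreal_leI)
        let ?s = "real k * h"
        have s: "0 < ?s" "?s \<le> T" using that h unfolding nh[symmetric] by (auto intro: mult_right_mono)
        have d: "1 < dist x a" using a by simp
        have "p ?s x a \<le> K * (?s * dist x a powr (- 1 - \<alpha> / 2) / V (dist x a))"
          using small[OF s] d s by (intro K) auto
        also have "\<dots> \<le> K * (T * 1 / V 1)"
        proof (intro mult_left_mono frac_le mult_mono)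
          show "dist x a powr (- 1 - \<alpha> / 2) \<le> 1"
            using powr_mono[of "- 1 - \<alpha> / 2" 0 "dist x a"] d alpha_pos by (auto split: if_splits)
        qed (use s d K V V_mono[of 1 "dist x a"] in auto)
        finally show "p ?s x a \<le> K * T / V 1" by simp
      qed
    qed
    also have "\<dots> \<le> ennreal (K * T / V 1) * (ennreal (1 / 2) * ennreal (V 4) + ennreal (V 6))"
      using emeasure_mono[of ?A "ball x 4" \<mu>]
      by (intro mult_left_mono add_mono) (auto simp: emeasure_ball sets_mu)
    also have "\<dots> = ennreal (K * T / V 1 * (1 / 2 * V 4 + V 6))"
    proof -
      have "ennreal (1 / 2) * ennreal (V 4) = ennreal (1 / 2 * V 4)"
        using V by (intro ennreal_mult[symmetric]) auto
      then have "ennreal (1 / 2) * ennreal (V 4) + ennreal (V 6) = ennreal (1 / 2 * V 4 + V 6)"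
        using V by (simp only:) (rule ennreal_plus[symmetric], auto)
      then show ?thesis using V K(1) T(1) by (simp only:) (rule ennreal_mult[symmetric], auto)
    qed
    finally have "ennreal 2 * (ennreal (1 / 2) * hit ?A h n x)
        \<le> ennreal 2 * ennreal (K * T / V 1 * (1 / 2 * V 4 + V 6))"
      by (rule mult_left_mono) simp
    also have "\<dots> = ennreal (L * T)"
      by (subst ennreal_mult'[symmetric]) (simp_all add: L_def ac_simps)
    finally show "hit ?A h n x \<le> ennreal (L * T)"
      by (simp only: mult.assoc[symmetric] ennreal_mult[symmetric]) simp
  qed
qed

text \<open>The complement of \<open>cball x 1\<close> is covered by the annulus of
  \<open>near_hit_le\<close> and the complement of \<open>ball x 4\<close>, to which
  \<open>far_hit_le\<close> applies with \<open>\<rho> = 2\<close>. The time \<open>T\<close>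
  depends neither on \<open>r\<close> nor on \<open>x\<close>.\<close>

lemma expected_exit_time_lower_small:
  "\<exists>c>0. \<forall>r>1. \<forall>x. ennreal c \<le> expected_exit_time X P x (ball x r)"
proof -
  obtain C where C: "0 < C"
    "\<And>\<rho> t x. 2 \<le> \<rho> \<Longrightarrow> 0 < t \<Longrightarrow> t powr (2 / \<alpha>) < \<rho> \<Longrightarrow>
      transition t (indicator (- ball x \<rho>)) x \<le> ennreal (C * t * \<rho> powr (- \<alpha> / 2))"
    using tail_upper by blast
  obtain L T0 where L: "0 < L" "0 < T0"
    "\<And>T h n x. 0 < h \<Longrightarrow> 0 < n \<Longrightarrow> real n * h = T \<Longrightarrow> T \<le> T0 \<Longrightarrow>
       hit (ball x 4 - cball x 1) h n x \<le> ennreal (L * T)"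
    using near_hit_le by blast
  \<comment> \<open>The last two entries make the far and the near hitting probability at most 1/4
    each; the first two keep the estimates for them applicable.\<close>
  define T where "T = Min {T0, 1 / 2, 1 / (8 * C * 2 powr (- \<alpha> / 2)), 1 / (4 * L)}"
  have T: "0 < T" "T \<le> T0" "T \<le> 1 / 2" "T \<le> 1 / (8 * C * 2 powr (- \<alpha> / 2))" "T \<le> 1 / (4 * L)"
    using L C by (auto simp: T_def)
  have CT: "C * T * 2 powr (- \<alpha> / 2) \<le> 1 / 8" using T(4) C by (simp add: field_simps)
  have LT: "L * T \<le> 1 / 4" using T(5) L by (simp add: field_simps)
  have T2: "T powr (2 / \<alpha>) < 2"
    using powr_less_mono2[of "2 / \<alpha>" T 1] T alpha_pos by simp
  show ?thesis
  proof (intro exI[of _ "T / 2"] conjI allI impI)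
    fix r :: real and x :: 'e assume r: "1 < r"
    show "ennreal (T / 2) \<le> expected_exit_time X P x (ball x r)"
    proof (rule expected_exit_time_ge[OF T(1) r])
      fix m
      let ?h = "T / 2 ^ m" and ?n = "2 ^ m :: nat"
      have h: "0 < ?h" "0 < ?n" "real ?n * ?h = T" using T by auto
      have sets: "ball x 4 - cball x 1 \<in> sets borel" "- ball x 4 \<in> sets borel"
        by (auto intro: sets.Diff)
      have "- cball x 1 = (ball x 4 - cball x 1) \<union> - ball x 4" by auto
      then have "hit (- cball x 1) ?h ?n x \<le> hit (ball x 4 - cball x 1) ?h ?n x + hit (- ball x 4) ?h ?n x"
        using hit_Un_le[OF _ sets, of ?h ?n x] h(1) by simp
      also have "\<dots> \<le> ennreal (1 / 4) + ennreal (2 * (1 / 8))"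
      proof (rule add_mono)
        have "hit (ball x 4 - cball x 1) ?h ?n x \<le> ennreal (L * T)"
          by (rule L(3)[OF h T(2)])
        also have "\<dots> \<le> ennreal (1 / 4)" by (rule ennreal_leI[OF LT])
        finally show "hit (ball x 4 - cball x 1) ?h ?n x \<le> ennreal (1 / 4)" .
        show "hit (- ball x 4) ?h ?n x \<le> ennreal (2 * (1 / 8))"
          by (rule far_hit_le[OF C(2) C(1) _ T2 CT _ h sets(2)]) auto
      qed
      also have "\<dots> = ennreal (1 / 2)" by (subst ennreal_plus[symmetric]) auto
      finally show "hit (- cball x 1) ?h ?n x \<le> ennreal (1 / 2)" .
    qed
  qed (use T in simp)
qed

lemma expected_exit_time_lower:
  "\<exists>c>0. \<forall>r>1. \<forall>x. ennreal (c * r powr (\<alpha> / 2)) \<le> expected_exit_time X P x (ball x r)"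
proof -
  obtain c1 where c1: "0 < c1"
    "\<And>r x. 8 \<le> r \<Longrightarrow> ennreal (c1 * r powr (\<alpha> / 2)) \<le> expected_exit_time X P x (ball x r)"
    using expected_exit_time_lower_large by blast
  obtain c2 where c2: "0 < c2" "\<And>r x. 1 < r \<Longrightarrow> ennreal c2 \<le> expected_exit_time X P x (ball x r)"
    using expected_exit_time_lower_small by blast
  \<comment> \<open>For \<open>r\<close> between 1 and 8 the constant bound is enough, as
    \<open>r powr (\<alpha> / 2)\<close> is then at most
    \<open>8 powr (\<alpha> / 2)\<close>.\<close>
  define c where "c = min c1 (c2 / 8 powr (\<alpha> / 2))"
  have c: "0 < c" "c \<le> c1" "c * 8 powr (\<alpha> / 2) \<le> c2"
    using c1(1) c2(1) by (auto simp: c_def min_def field_simps)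
  show ?thesis
  proof (intro exI[of _ c] conjI allI impI)
    fix r :: real and x :: 'e assume r: "1 < r"
    show "ennreal (c * r powr (\<alpha> / 2)) \<le> expected_exit_time X P x (ball x r)"
    proof (cases "8 \<le> r")
      case True
      have "ennreal (c * r powr (\<alpha> / 2)) \<le> ennreal (c1 * r powr (\<alpha> / 2))"
        using c by (intro ennreal_leI mult_right_mono) auto
      also note c1(2)[OF True]
      finally show ?thesis .
    next
      case False
      have "c * r powr (\<alpha> / 2) \<le> c * 8 powr (\<alpha> / 2)"
        using False r c alpha_pos by (intro mult_left_mono powr_mono2) auto
      then have "ennreal (c * r powr (\<alpha> / 2)) \<le> ennreal c2"
        using c by (intro ennreal_leI) linarith
      also note c2(2)[OF r]
      finally show ?thesis .
    qed
  qed (rule c)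
qed

end

theorem theorem4p3:
  fixes \<alpha> :: real
    and \<mu> :: "'e::metric_space measure"
    and p :: "real \<Rightarrow> 'e \<Rightarrow> 'e \<Rightarrow> real"
    and V :: "real \<Rightarrow> real"
    and M :: "'w measure"
    and F :: "ennreal \<Rightarrow> 'w measure"
    and X :: "real \<Rightarrow> 'w \<Rightarrow> 'e"
    and P :: "'e \<Rightarrow> 'w measure"
  assumes "0 < \<alpha>" and "\<alpha> < 2"
    and "heat_kernel \<mu> p"
    and "strong_markov_process M F X P"
    and "has_transition_density M X P \<mu> p"
    and "volume_growth \<mu> V"
    and "volume_condition V"
    and "kernel_estimate \<alpha> V p"
  shows "(\<exists>c::real>0. \<forall>r>1. \<forall>x. \<forall>y\<in>ball x r.
            expected_exit_time X P y (ball x r) \<le> ennreal (c * r powr (\<alpha> / 2))) \<and>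
         (\<exists>c::real>0. \<forall>r>1. \<forall>x.
            ennreal (1 / c) < expected_exit_time X P x (ball x r) / ennreal (r powr (\<alpha> / 2)) \<and>
            expected_exit_time X P x (ball x r) / ennreal (r powr (\<alpha> / 2)) < ennreal c)"
proof -
  interpret heat_kernel \<mu> p by fact
  interpret strong_markov_process M F X P by fact
  interpret stable_like \<mu> p M F X P V \<alpha>
    by unfold_locales (use assms in auto)
  obtain c1 where c1: "0 < c1" "\<And>r x y. 1 < r \<Longrightarrow> y \<in> ball x r \<Longrightarrow>
      expected_exit_time X P y (ball x r) \<le> ennreal (c1 * r powr (\<alpha> / 2))"
    using expected_exit_time_upper by blast
  obtain c2 where c2: "0 < c2" "\<And>r x. 1 < r \<Longrightarrow>
      ennreal (c2 * r powr (\<alpha> / 2)) \<le> expected_exit_time X P x (ball x r)"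
    using expected_exit_time_lower by blast
  \<comment> \<open>The summand 1 and the factor 2 make both comparisons strict.\<close>
  define c where "c = max (c1 + 1) (2 / c2)"
  have c: "0 < c" "c1 < c" "1 / c < c2"
  proof -
    show "0 < c" "c1 < c" using c1(1) by (auto simp: c_def)
    have "1 / c \<le> 1 / (2 / c2)" using c2(1) by (intro divide_left_mono) (auto simp: c_def less_max_iff_disj)
    also have "\<dots> < c2" using c2(1) by simp
    finally show "1 / c < c2" .
  qed
  show ?thesis
  proof (rule conjI)
    show "\<exists>c::real>0. \<forall>r>1. \<forall>x. \<forall>y\<in>ball x r.
            expected_exit_time X P y (ball x r) \<le> ennreal (c * r powr (\<alpha> / 2))"
      using c1 by blast
  next
    show "\<exists>c::real>0. \<forall>r>1. \<forall>x.
            ennreal (1 / c) < expected_exit_time X P x (ball x r) / ennreal (r powr (\<alpha> / 2)) \<and>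
            expected_exit_time X P x (ball x r) / ennreal (r powr (\<alpha> / 2)) < ennreal c"
    proof (intro exI[of _ c] conjI allI impI c(1))
      fix r :: real and x :: 'e assume r: "1 < r"
      let ?R = "r powr (\<alpha> / 2)" and ?E = "expected_exit_time X P x (ball x r)"
      have R: "0 < ?R" using r by simp
      have div: "ennreal (b * ?R) / ennreal ?R = ennreal b" if "0 < b" for b
        using R that by (simp add: divide_ennreal)
      have "ennreal (1 / c) < ennreal c2" using c c2(1) by (intro ennreal_lessI) auto
      also have "\<dots> \<le> ?E / ennreal ?R"
        using divide_right_mono_ennreal[OF c2(2)[OF r, of x], of "ennreal ?R"] div[OF c2(1)] by simp
      finally show "ennreal (1 / c) < ?E / ennreal ?R" .
      have "?E / ennreal ?R \<le> ennreal c1"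
        using divide_right_mono_ennreal[OF c1(2)[OF r, of x x], of "ennreal ?R"] div[OF c1(1)] r by simp
      also have "\<dots> < ennreal c" using c by (intro ennreal_lessI) auto
      finally show "?E / ennreal ?R < ennreal c" .
    qed
  qed
qed

end
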